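(* Let $T$ be a tree as in the context, let $\mathrm{Bic}(T)$ be its lattice of biclosed sets, and let $\mathcal{S}_T$ be the poset of labels. The edge labeling $\widetilde{\lambda}:\mathrm{Cov}(\mathrm{Bic}(T))\to\mathcal{S}_T$, defined by $\widetilde{\lambda}(B,B\sqcup\{s\})=s_{\mathcal{D}}$ where $\mathcal{D}$ is the set of splits of $s$ contained in $B$, is a CU-labeling of $\mathrm{Bic}(T)$.
   Context: Let $T$ be a finite tree embedded in a disk so that exactly its leaves (degree-one vertices) lie on the boundary, and every non-leaf vertex has degree at least $3$. The embedding determines a cyclic ordering of the edges incident to each vertex. An acyclic path is a sequence $(v_1,\dots,v_n)$, $n\ge 2$, of pairwise distinct vertices with $v_j,v_{j+1}$ adjacent; it is determined by its endpoints and denoted $[v_1,v_n]$. It is a segment if for each $1\le j\le n-2$, the edge $\{v_{j+1},v_{j+2}\}$ is immediately clockwise or immediately counterclockwise from $\{v_j,v_{j+1}\}$ in the cyclic order at $v_{j+1}$. $\mathrm{Seg}(T)$ is the set of segments. If segments $s_1=(v_1,\dots,v_k)$ and $s_2=(v_k,\dots,v_n)$ share only the vertex $v_k$, their composition is the acyclic path $s_1\circ s_2=(v_1,\dots,v_n)$; they are composable if $s_1\circ s_2$ is a segment. A set $B\subseteq\mathrm{Seg}(T)$ is closed if $s_1\circ s_2\in B$ for all composable $s_1,s_2\in B$, and biclosed if both $B$ and $\mathrm{Seg}(T)\setminus B$ are closed. $\mathrm{Bic}(T)$ is the set of biclosed sets ordered by inclusion; it is known to be a finite lattice whose covering relations are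 exactly the pairs $(B,B\sqcup\{s\})$ with both sets biclosed. A split of a segment $t$ is a segment that is a proper subsegment of $t$ sharing an endpoint with $t$. A break of a segment $[a,c]$ is a pair $\{[a,b],[b,c]\}$ of splits where $b$ is a vertex of $[a,c]$ strictly between $a$ and $c$; a segment with $m+2$ vertices has $m$ breaks. $\mathcal{S}_T$ is the set of pairs $(s,\mathcal{D})$, written $s_{\mathcal{D}}$, with $s\in\mathrm{Seg}(T)$ having $m$ breaks, $\mathcal{D}$ a set of $m$ splits of $s$, no two of which lie in the same break of $s$; it is partially ordered by $s'_{\mathcal{D}'}<s_{\mathcal{D}}$ iff $s'$ is a proper subsegment of $s$. For a finite lattice $L$ and poset $Q$, a labeling $\lambda:\mathrm{Cov}(L)\to Q$ is a CN-labeling if both $L$ and its dual satisfy: whenever $z\lessdot x$, $z\lessdot y$, and $C_1,C_2$ are maximal chains of $[z,x\vee y]$ with $x\in C_1$, $y\in C_2$, then (CN1) the elements $x'\in C_1$, $y'\in C_2$ covered by $x\vee y$ satisfy $\lambda(x',x\vee y)=\lambda(z,y)$ and $\lambda(y',x\vee y)=\lambda(z,x)$; (CN2) for each cover $(u,v)$ in $C_1$ with $z<u$, $v<x\vee y$, one has $\lambda(z,x),\lambda(z,y)<_Q\lambda(u,v)$; (CN3) the labels on the covers of $C_1$ are pairwise distinct. It is a CU-labeling if moreover (CU1) $\lambda(j_*,j)\neq\lambda(j'_*,j')$ for distinct join-irreducibles $j,j'$ (where $j_*$ is the unique element covered by $j$), and (CU2) $\lambda(m,m^* )\ne\lambda(m',m'^*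 )$ for distinct meet-irreducibles $m,m'$ (where $m^*$ is the unique element covering $m$). *)

theory Defs
  imports "HOL-Algebra.Lattice" "HOL-Algebra.Complete_Lattice" "HOL-Combinatorics.Orbits"
begin

section \<open>Trees embedded in a disk\<close>

text \<open>
  An embedding of a tree in a disk, with exactly the leaves on the boundary, is recorded by its
  rotation system: \<open>cw T v e\<close> is the edge immediately clockwise from \<open>e\<close> among the edges incident
  to the vertex \<open>v\<close>. Every rotation system of a finite tree comes from such an embedding, and
  segments, biclosed sets and labels depend on the embedding only through these cyclic orders.
\<close>

record 'a embedded_graph =
  verts :: "'a set"
  edges :: "'a set set"
  cw :: "'a \<Rightarrow> 'a set \<Rightarrow> 'a set"

definition incident :: "'a embedded_graph \<Rightarrow> 'a \<Rightarrow> 'a set set" where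
  "incident T v = {e \<in> edges T. v \<in> e}"

definition degree :: "'a embedded_graph \<Rightarrow> 'a \<Rightarrow> nat" where
  "degree T v = card (incident T v)"

definition leaf :: "'a embedded_graph \<Rightarrow> 'a \<Rightarrow> bool" where
  "leaf T v \<longleftrightarrow> v \<in> verts T \<and> degree T v = 1"

definition acyclic_path :: "'a embedded_graph \<Rightarrow> 'a list \<Rightarrow> bool" where
  "acyclic_path T p \<longleftrightarrow>
     length p \<ge> 2 \<and> distinct p \<and> set p \<subseteq> verts T \<and>
     (\<forall>j. Suc j < length p \<longrightarrow> {p ! j, p ! Suc j} \<in> edges T)"

definition is_tree :: "'a embedded_graph \<Rightarrow> bool" where
  "is_tree T \<longleftrightarrow>
     verts T \<noteq> {} \<and>
     (\<forall>e \<in> edges T. \<exists>u \<in> verts T. \<exists>v \<in> verts T. u \<noteq> v \<and> e = {u, v}) \<and>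
     (\<forall>u \<in> verts T. \<forall>v \<in> verts T. u \<noteq> v \<longrightarrow>
        (\<exists>p. acyclic_path T p \<and> hd p = u \<and> last p = v)) \<and>
     \<not> (\<exists>p. acyclic_path T p \<and> length p \<ge> 3 \<and> {last p, hd p} \<in> edges T)"

definition disk_tree :: "'a embedded_graph \<Rightarrow> bool" where
  "disk_tree T \<longleftrightarrow>
     finite (verts T) \<and> is_tree T \<and>
     (\<forall>v \<in> verts T. cyclic_on (cw T v) (incident T v)) \<and>
     (\<forall>v \<in> verts T. \<not> leaf T v \<longrightarrow> degree T v \<ge> 3)"


section \<open>Segments\<close>

definition segment_path :: "'a embedded_graph \<Rightarrow> 'a list \<Rightarrow> bool" where
  "segment_path T p \<longleftrightarrow>
     acyclic_path T p \<and>
     (\<forall>j. Suc (Suc j) < length p \<longrightarrow>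
        (let v = p ! Suc j; e = {p ! j, v}; e' = {v, p ! Suc (Suc j)}
         in cw T v e = e' \<or> cw T v e' = e))"

text \<open>
  The paths \<open>(v\<^sub>1, \<dots>, v\<^sub>n)\<close> and \<open>(v\<^sub>n, \<dots>, v\<^sub>1)\<close> are the same segment \<open>[v\<^sub>1, v\<^sub>n] = [v\<^sub>n, v\<^sub>1]\<close>.
  In a tree an acyclic path is determined, up to reversal, by its set of vertices, so segments are
  represented by their vertex sets; subsegments are then subsets.
\<close>

definition Seg :: "'a embedded_graph \<Rightarrow> 'a set set" where
  "Seg T = {set p | p. segment_path T p}"

text \<open>Paths can be read in both directions, so \<open>ends T [a, c] = {a, c}\<close>.\<close>

definition ends :: "'a embedded_graph \<Rightarrow> 'a set \<Rightarrow> 'a set" where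
  "ends T s = {hd p | p. acyclic_path T p \<and> set p = s}"

text \<open>The vertex set of the composition of \<open>s\<close> and \<open>t\<close> is \<open>s \<union> t\<close>.\<close>

definition composable :: "'a embedded_graph \<Rightarrow> 'a set \<Rightarrow> 'a set \<Rightarrow> bool" where
  "composable T s t \<longleftrightarrow>
     s \<in> Seg T \<and> t \<in> Seg T \<and>
     (\<exists>v. v \<in> ends T s \<and> v \<in> ends T t \<and> s \<inter> t = {v}) \<and>
     s \<union> t \<in> Seg T"

definition closed_segs :: "'a embedded_graph \<Rightarrow> 'a set set \<Rightarrow> bool" where
  "closed_segs T B \<longleftrightarrow> B \<subseteq> Seg T \<and> (\<forall>s \<in> B. \<forall>t \<in> B. composable T s t \<longrightarrow> s \<union> t \<in> B)"

definition biclosed :: "'a embedded_graph \<Rightarrow> 'a set set \<Rightarrow> bool" where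
  "biclosed T B \<longleftrightarrow> B \<subseteq> Seg T \<and> closed_segs T B \<and> closed_segs T (Seg T - B)"

definition Bic :: "'a embedded_graph \<Rightarrow> 'a set set gorder" where
  "Bic T = \<lparr>carrier = {B. biclosed T B}, eq = (=), le = (\<subseteq>)\<rparr>"


section \<open>Labels\<close>

definition splits :: "'a embedded_graph \<Rightarrow> 'a set \<Rightarrow> 'a set set" where
  "splits T t = {s \<in> Seg T. s \<subset> t \<and> ends T s \<inter> ends T t \<noteq> {}}"

definition breaks :: "'a embedded_graph \<Rightarrow> 'a set \<Rightarrow> 'a set set set" where
  "breaks T t =
     {{r, s} | r s a b c.
        ends T t = {a, c} \<and> b \<in> t - {a, c} \<and>
        r \<in> splits T t \<and> ends T r = {a, b} \<and>
        s \<in> splits T t \<and> ends T s = {b, c}}"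

definition Labels :: "'a embedded_graph \<Rightarrow> ('a set \<times> 'a set set) set" where
  "Labels T =
     {(s, D). s \<in> Seg T \<and> D \<subseteq> splits T s \<and> card D = card (breaks T s) \<and>
        (\<forall>r \<in> D. \<forall>r' \<in> D. r \<noteq> r' \<longrightarrow> \<not> (\<exists>b \<in> breaks T s. r \<in> b \<and> r' \<in> b))}"

definition label_poset :: "'a embedded_graph \<Rightarrow> ('a set \<times> 'a set set) gorder" where
  "label_poset T =
     \<lparr>carrier = Labels T, eq = (=), le = (\<lambda>l l'. l = l' \<or> fst l \<subset> fst l')\<rparr>"

definition bic_label ::
  "'a embedded_graph \<Rightarrow> 'a set set \<Rightarrow> 'a set set \<Rightarrow> 'a set \<times> 'a set set" where
  "bic_label T B B' =
     (let s = (THE s. s \<notin> B \<and> B' = B \<union> {s}) in (s, {r \<in> splits T s. r \<in> B}))"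


section \<open>CN- and CU-labelings\<close>

definition covers :: "'b gorder \<Rightarrow> 'b \<Rightarrow> 'b \<Rightarrow> bool" where
  "covers L x y \<longleftrightarrow>
     x \<in> carrier L \<and> y \<in> carrier L \<and> x \<sqsubset>\<^bsub>L\<^esub> y \<and>
     \<not> (\<exists>w \<in> carrier L. x \<sqsubset>\<^bsub>L\<^esub> w \<and> w \<sqsubset>\<^bsub>L\<^esub> y)"

definition max_chain :: "'b gorder \<Rightarrow> 'b \<Rightarrow> 'b \<Rightarrow> 'b set \<Rightarrow> bool" where
  "max_chain L z w C \<longleftrightarrow> pred_on.maxchain \<lbrace>z..w\<rbrace>\<^bsub>L\<^esub> (\<lambda>u v. u \<sqsubset>\<^bsub>L\<^esub> v) C"

definition CN_conditions :: "'b gorder \<Rightarrow> 'q gorder \<Rightarrow> ('b \<Rightarrow> 'b \<Rightarrow> 'q) \<Rightarrow> bool" where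
  "CN_conditions L Q lab \<longleftrightarrow>
     (\<forall>z x y C1 C2.
        covers L z x \<and> covers L z y \<and>
        max_chain L z (x \<squnion>\<^bsub>L\<^esub> y) C1 \<and> max_chain L z (x \<squnion>\<^bsub>L\<^esub> y) C2 \<and> x \<in> C1 \<and> y \<in> C2 \<longrightarrow>
        \<comment> \<open>CN1\<close>
        (\<forall>x' \<in> C1. \<forall>y' \<in> C2. covers L x' (x \<squnion>\<^bsub>L\<^esub> y) \<and> covers L y' (x \<squnion>\<^bsub>L\<^esub> y) \<longrightarrow>
           lab x' (x \<squnion>\<^bsub>L\<^esub> y) = lab z y \<and> lab y' (x \<squnion>\<^bsub>L\<^esub> y) = lab z x) \<and>
        \<comment> \<open>CN2\<close>
        (\<forall>u \<in> C1. \<forall>v \<in> C1. covers L u v \<and> z \<sqsubset>\<^bsub>L\<^esub> u \<and> v \<sqsubset>\<^bsub>L\<^esub> x \<squnion>\<^bsub>L\<^esub> y \<longrightarrow>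
           lab z x \<sqsubset>\<^bsub>Q\<^esub> lab u v \<and> lab z y \<sqsubset>\<^bsub>Q\<^esub> lab u v) \<and>
        \<comment> \<open>CN3\<close>
        inj_on (\<lambda>(u, v). lab u v) {(u, v). u \<in> C1 \<and> v \<in> C1 \<and> covers L u v})"

definition CN_labeling :: "'b gorder \<Rightarrow> 'q gorder \<Rightarrow> ('b \<Rightarrow> 'b \<Rightarrow> 'q) \<Rightarrow> bool" where
  "CN_labeling L Q lab \<longleftrightarrow>
     lattice L \<and> finite (carrier L) \<and> partial_order Q \<and>
     (\<forall>x y. covers L x y \<longrightarrow> lab x y \<in> carrier Q) \<and>
     CN_conditions L Q lab \<and>
     CN_conditions (inv_gorder L) Q (\<lambda>x y. lab y x)"

definition join_irreducible :: "'b gorder \<Rightarrow> 'b \<Rightarrow> bool" where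
  "join_irreducible L j \<longleftrightarrow>
     j \<in> carrier L \<and> \<not> least L j (carrier L) \<and>
     (\<forall>x \<in> carrier L. \<forall>y \<in> carrier L. j = x \<squnion>\<^bsub>L\<^esub> y \<longrightarrow> j = x \<or> j = y)"

definition meet_irreducible :: "'b gorder \<Rightarrow> 'b \<Rightarrow> bool" where
  "meet_irreducible L m \<longleftrightarrow>
     m \<in> carrier L \<and> \<not> greatest L m (carrier L) \<and>
     (\<forall>x \<in> carrier L. \<forall>y \<in> carrier L. m = x \<sqinter>\<^bsub>L\<^esub> y \<longrightarrow> m = x \<or> m = y)"

text \<open>
  In a finite lattice a join-irreducible element covers exactly one element, and a meet-irreducible
  element is covered by exactly one; these are \<open>i\<close>, \<open>i'\<close>, respectively \<open>n\<close>, \<open>n'\<close>, below.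
\<close>

definition CU_labeling :: "'b gorder \<Rightarrow> 'q gorder \<Rightarrow> ('b \<Rightarrow> 'b \<Rightarrow> 'q) \<Rightarrow> bool" where
  "CU_labeling L Q lab \<longleftrightarrow>
     CN_labeling L Q lab \<and>
     \<comment> \<open>CU1\<close>
     (\<forall>j j' i i'. join_irreducible L j \<and> join_irreducible L j' \<and> j \<noteq> j' \<and>
        covers L i j \<and> covers L i' j' \<longrightarrow> lab i j \<noteq> lab i' j') \<and>
     \<comment> \<open>CU2\<close>
     (\<forall>m m' n n'. meet_irreducible L m \<and> meet_irreducible L m' \<and> m \<noteq> m' \<and>
        covers L m n \<and> covers L m' n' \<longrightarrow> lab m n \<noteq> lab m' n')"

end

theory Submission
  imports Defs
begin

text \<open>
  Composition makes the segments a partial commutative semigroup in which two decompositions of the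
  same segment have a common refinement. This gives that the closure of a union of biclosed sets
  is biclosed, so it is their join, and that a strict inclusion of biclosed sets can be refined by
  adding one segment at a time. The join of \<open>B \<union> {s}\<close> and \<open>B \<union> {t}\<close> is \<open>B \<union> {s, t}\<close> together
  with \<open>s \<circ> t\<close> when this is defined, so the interval above \<open>B\<close> is a square or a hexagon, and
  (CN1)-(CN3) are read off. Complementation exchanges the lattice with its dual and keeps the segment
  of a label, which gives the dual conditions. For (CU1), if two join-irreducibles have the label
  \<open>s\<^sub>D\<close>, then \<open>s\<close> is still in their meet; a biclosed subset of a join-irreducible that contains the
  segment of its label is the whole of it.
\<close>

section \<open>Biclosed sets in a partial semigroup of segments\<close>

text \<open>Composition is union of vertex sets, and \<open>comp_inter\<close> replaces the
  condition that the two parts meet in one vertex. In \<open>refine\<close> the cut points of two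
  decompositions coincide or one comes first; orientation doubles these three cases to six. In
  \<open>assoc\<close> the segment \<open>b\<close> continues past \<open>t\<close> or past
  \<open>s\<close>. In \<open>split_extend\<close> a part containing an end of the whole still
  contains it when enlarged.\<close>

locale segment_system =
  fixes S :: "'a set set" and comp :: "'a set \<Rightarrow> 'a set \<Rightarrow> bool"
  assumes finite_S: "finite S"
    and finite_segment: "s \<in> S \<Longrightarrow> finite s"
    and comp_sym: "comp s t \<Longrightarrow> comp t s"
    and comp_mem: "comp s t \<Longrightarrow> s \<in> S \<and> t \<in> S \<and> s \<union> t \<in> S"
    and comp_inter: "comp s t \<Longrightarrow> r \<in> S \<Longrightarrow> \<not> r \<subseteq> s \<inter> t"
    and refine: "comp s t \<Longrightarrow> comp a b \<Longrightarrow> s \<union> t = a \<union> b \<Longrightarrow>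
      s = a \<and> t = b \<or> s = b \<and> t = a \<or>
      (\<exists>r. comp s r \<and> a = s \<union> r \<and> comp r b \<and> t = r \<union> b) \<or>
      (\<exists>r. comp a r \<and> s = a \<union> r \<and> comp r t \<and> b = r \<union> t) \<or>
      (\<exists>r. comp s r \<and> b = s \<union> r \<and> comp r a \<and> t = r \<union> a) \<or>
      (\<exists>r. comp b r \<and> s = b \<union> r \<and> comp r t \<and> a = r \<union> t)"
    and assoc: "comp s t \<Longrightarrow> comp (s \<union> t) b \<Longrightarrow>
      comp t b \<and> comp s (t \<union> b) \<or> comp s b \<and> comp t (s \<union> b)"
    and split_extend: "comp r b \<Longrightarrow> r \<subseteq> r' \<Longrightarrow> r' \<in> S \<Longrightarrow> r' \<subset> r \<union> b \<Longrightarrow>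
      \<exists>b'. comp r' b' \<and> r' \<union> b' = r \<union> b"
begin

lemma refine_cases:
  assumes "comp s t" "comp a b" "s \<union> t = a \<union> b"
  obtains "s = a" "t = b" | "s = b" "t = a"
    | r where "comp s r" "a = s \<union> r" "comp r b" "t = r \<union> b"
    | r where "comp a r" "s = a \<union> r" "comp r t" "b = r \<union> t"
    | r where "comp s r" "b = s \<union> r" "comp r a" "t = r \<union> a"
    | r where "comp b r" "s = b \<union> r" "comp r t" "a = r \<union> t"
  using refine[OF assms] by (elim disjE exE conjE) (rule that; assumption)+

definition bic :: "'a set set \<Rightarrow> bool" where
  "bic B \<longleftrightarrow> B \<subseteq> S \<and> (\<forall>s t. comp s t \<and> s \<in> B \<and> t \<in> B \<longrightarrow> s \<union> t \<in> B)
     \<and> (\<forall>s t. comp s t \<and> s \<notin> B \<and> t \<notin> B \<longrightarrow> s \<union> t \<notin> B)"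

definition split :: "'a set \<Rightarrow> 'a set \<Rightarrow> bool" where
  "split r s \<longleftrightarrow> (\<exists>r'. comp r r' \<and> r \<union> r' = s)"

lemma comp_psubset: "comp s t \<Longrightarrow> s \<subset> s \<union> t" "comp s t \<Longrightarrow> t \<subset> s \<union> t"
  using comp_inter[of s t s] comp_inter[of s t t] comp_mem[of s t] by blast+

lemma not_comp_self: "\<not> comp s s"
  using comp_psubset by blast

lemma split_psubset: "split r s \<Longrightarrow> r \<subset> s"
  unfolding split_def using comp_psubset by blast

lemma bic_subset: "bic B \<Longrightarrow> s \<in> B \<Longrightarrow> s \<in> S"
  unfolding bic_def by blast

lemma bic_closed: "bic B \<Longrightarrow> comp s t \<Longrightarrow> s \<in> B \<Longrightarrow> t \<in> B \<Longrightarrow> s \<union> t \<in> B"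
  unfolding bic_def by blast

lemma bic_coclosed: "bic B \<Longrightarrow> comp s t \<Longrightarrow> s \<union> t \<in> B \<Longrightarrow> s \<in> B \<or> t \<in> B"
  unfolding bic_def by blast

lemma bic_compl: "bic B \<Longrightarrow> bic (S - B)"
  using comp_mem unfolding bic_def by blast

lemma compl_compl: "bic B \<Longrightarrow> S - (S - B) = B"
  unfolding bic_def by blast

text \<open>Refine \<open>r \<union> a\<close> against \<open>r \<union> b\<close>. Any outcome
  other than \<open>a = b\<close> makes \<open>r\<close> a proper part of itself, or puts one of
  \<open>r\<close>, \<open>b\<close> inside the other, which \<open>comp_inter\<close>
  forbids.\<close>

lemma comp_unique:
  assumes "comp r a" "comp r b" "r \<union> a = r \<union> b"
  shows "a = b"
proof -
  note sub = comp_psubset[OF assms(1)] comp_psubset[OF assms(2)]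
  have "\<not> (\<exists>q. comp r q \<and> r = r \<union> q)" "\<not> (\<exists>q. comp r q \<and> b = r \<union> q)"
    "\<not> (\<exists>q. comp b q \<and> r = b \<union> q)"
    using comp_psubset comp_inter[OF assms(2)] comp_mem[OF assms(2)] by blast+
  then show ?thesis
    using refine[OF assms] by blast
qed

section \<open>Closure under composition\<close>

inductive_set cl :: "'a set set \<Rightarrow> 'a set set" for X :: "'a set set" where
  base: "s \<in> X \<Longrightarrow> s \<in> cl X"
| step: "s \<in> cl X \<Longrightarrow> t \<in> cl X \<Longrightarrow> comp s t \<Longrightarrow> s \<union> t \<in> cl X"

text \<open>Induction on how \<open>u\<close> was generated. A break of \<open>s \<union> t\<close>
  cuts one of the two parts, say \<open>t = r \<union> b\<close> with
  \<open>a = s \<union> r\<close>. By induction \<open>b\<close> or \<open>r\<close> is in the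
  closure, and in the latter case so is \<open>a\<close>.\<close>

lemma cl_coclosed:
  assumes X: "\<And>s t. comp s t \<Longrightarrow> s \<union> t \<in> X \<Longrightarrow> s \<in> X \<or> t \<in> X"
  assumes "u \<in> cl X" "comp a b" "u = a \<union> b"
  shows "a \<in> cl X \<or> b \<in> cl X"
  using assms(2-)
proof (induction arbitrary: a b rule: cl.induct)
  case (base s)
  then show ?case using X cl.base by blast
next
  case (step s t)
  from refine[OF \<open>comp s t\<close> \<open>comp a b\<close> \<open>s \<union> t = a \<union> b\<close>] show ?case
    by (elim disjE exE conjE) (use step cl.step comp_sym in \<open>metis Un_commute\<close>)+
qed

lemma bic_cl:
  assumes "X \<subseteq> S" and X: "\<And>s t. comp s t \<Longrightarrow> s \<union> t \<in> X \<Longrightarrow> s \<in> X \<or> t \<in> X"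
  shows "bic (cl X)"
proof -
  have "s \<in> S" if "s \<in> cl X" for s
    using that by induction (use assms comp_mem in auto)
  then show ?thesis
    unfolding bic_def using cl_coclosed[OF X] cl.step by blast
qed

lemma bic_join: "bic x \<Longrightarrow> bic y \<Longrightarrow> bic (cl (x \<union> y))"
  by (rule bic_cl) (auto dest: bic_subset bic_coclosed)

lemma subset_cl: "X \<subseteq> cl X"
  using cl.base by blast

lemma cl_least:
  assumes "X \<subseteq> B" "bic B"
  shows "cl X \<subseteq> B"
proof
  fix s assume "s \<in> cl X"
  then show "s \<in> B" by induction (use assms bic_closed in auto)
qed

text \<open>
  Among the elements of the difference all of whose breaks have a part in \<open>B\<close>, take a largest one.
  If composing it with some element of \<open>B\<close> left \<open>B\<close>, a smallest such composition would be a larger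
  element of this kind.
\<close>

lemma cover_exists:
  assumes B: "bic B" and B': "bic B'" and sub: "B \<subset> B'"
  shows "\<exists>s \<in> B' - B. bic (insert s B)"
proof -
  define P where "P s \<longleftrightarrow> s \<in> B' - B \<and> (\<forall>a b. comp a b \<longrightarrow> a \<union> b = s \<longrightarrow> a \<in> B \<or> b \<in> B)" for s
  have card_less: "card a < card b" if "a \<subset> b" "b \<in> S" for a b
    using that finite_segment psubset_card_mono by blast
  have "\<exists>s. P s"
  proof -
    \<comment> \<open>A smallest element of the difference qualifies: by coclosedness of
      \<open>B'\<close>, a break with both parts outside \<open>B\<close> would yield a smaller
      one.\<close>
    obtain s where s: "s \<in> B' - B" "\<And>t. t \<in> B' - B \<Longrightarrow> card s \<le> card t"
      using sub ex_has_least_nat[of "\<lambda>s. s \<in> B' - B" _ card] by blast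
    have "a \<in> B \<or> b \<in> B" if "comp a b" "a \<union> b = s" for a b
    proof (rule ccontr)
      assume "\<not> (a \<in> B \<or> b \<in> B)"
      moreover have "a \<in> B' \<or> b \<in> B'"
        using bic_coclosed[OF B' \<open>comp a b\<close>] that s by auto
      ultimately have "a \<in> B' - B \<or> b \<in> B' - B" by blast
      moreover have "card a < card s" "card b < card s"
        using card_less[of a s] card_less[of b s] comp_psubset[OF that(1)] comp_mem[OF that(1)] that(2)
        by auto
      ultimately show False using s(2)[of a] s(2)[of b] by auto
    qed
    then show ?thesis using s(1) unfolding P_def by blast
  qed
  moreover have "card s \<le> Max (card ` S)" if "P s" for s
    using that finite_S bic_subset[OF B', of s] unfolding P_def by simp
  ultimately have "\<exists>s. P s \<and> (\<forall>t. P t \<longrightarrow> card t \<le> card s)"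
    using ex_has_greatest_nat[of P _ card "Suc (Max (card ` S))"] by (metis less_Suc_eq_le)
  then obtain s where s: "P s" "\<And>t. P t \<Longrightarrow> card t \<le> card s" by blast
  have sB: "s \<in> B'" "s \<notin> B" "s \<in> S" using s(1) bic_subset[OF B', of s] unfolding P_def by simp_all
  have closed: "s \<union> t \<in> B" if "comp s t" "t \<in> B" for t
  proof (rule ccontr)
    assume "s \<union> t \<notin> B"
    then have "comp s t \<and> t \<in> B \<and> s \<union> t \<notin> B" using that by simp
    from ex_has_least_nat[of "\<lambda>t. comp s t \<and> t \<in> B \<and> s \<union> t \<notin> B", OF this, of card]
    obtain t where t: "comp s t \<and> t \<in> B \<and> s \<union> t \<notin> B"
      and least: "\<And>t'. comp s t' \<and> t' \<in> B \<and> s \<union> t' \<notin> B \<Longrightarrow> card t \<le> card t'" by metis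
    \<comment> \<open>Minimality of \<open>t\<close>: a proper part of \<open>t\<close> that lies in
      \<open>B\<close> and touches \<open>s\<close> composes with \<open>s\<close> inside
      \<open>B\<close>.\<close>
    have prefix: "r \<union> s \<in> B" if "comp s r" "comp r b" "t = r \<union> b" "r \<in> B" for r b
    proof (rule ccontr)
      assume "r \<union> s \<notin> B"
      then have "card t \<le> card r" using least[of r] that by (simp add: Un_commute)
      moreover have "card r < card t"
        using card_less[of r t] comp_psubset[OF that(2)] comp_mem[OF that(2)] that(3) by auto
      ultimately show False by simp
    qed
    have "a \<in> B \<or> b \<in> B" if ab: "comp a b" "a \<union> b = s \<union> t" for a b
    proof -
      have sP: "x \<in> B \<or> y \<in> B" if "comp x y" "s = x \<union> y" for x y
        using s(1) that unfolding P_def by blast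
      have tB: "x \<in> B \<or> y \<in> B" if "comp x y" "t = x \<union> y" for x y
        using bic_coclosed[OF B] t that by blast
      have "comp s t" using t by simp
      from this ab(1) ab(2)[symmetric] show ?thesis
      \<comment> \<open>The middle piece \<open>r\<close> comes from \<open>t\<close> or from
        \<open>s\<close>. If from \<open>t\<close>, then \<open>prefix\<close> absorbs it into the
        side of \<open>s\<close>; if from \<open>s\<close>, closedness of \<open>B\<close> absorbs
        it into the side of \<open>t\<close>.\<close>
      proof (cases rule: refine_cases)
        case (3 r)
        then show ?thesis using tB[of r b] t prefix[of r b] by (auto simp: Un_commute)
      next
        case (4 r)
        then show ?thesis using sP[of a r] t bic_closed[OF B, of r t] by auto
      next
        case (5 r)
        then show ?thesis using tB[of r a] t prefix[of r a] by (auto simp: Un_commute)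
      next
        case (6 r)
        then show ?thesis using sP[of b r] t bic_closed[OF B, of r t] by auto
      qed (use t in auto)
    qed
    then have "P (s \<union> t)"
      using t subsetD[OF psubset_imp_subset[OF sub]] bic_closed[OF B', of s t] sB unfolding P_def by simp
    moreover have "card s < card (s \<union> t)"
      using t card_less[of s "s \<union> t"] comp_psubset[of s t] comp_mem[of s t] by auto
    ultimately show False using s(2)[of "s \<union> t"] by simp
  qed
  have "bic (insert s B)"
    unfolding bic_def
  proof (intro conjI allI impI)
    show "insert s B \<subseteq> S" using sB B unfolding bic_def by blast
    fix a b
    {
      assume "comp a b \<and> a \<in> insert s B \<and> b \<in> insert s B"
      then show "a \<union> b \<in> insert s B"
        using closed bic_closed[OF B] comp_sym not_comp_self by (metis Un_commute insert_iff)
    next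
      assume "comp a b \<and> a \<notin> insert s B \<and> b \<notin> insert s B"
      then show "a \<union> b \<notin> insert s B"
        using s(1) bic_coclosed[OF B] unfolding P_def by blast
    }
  qed
  then show ?thesis using sB by blast
qed

section \<open>Covering relations and the join of two covers\<close>

definition cov :: "'a set set \<Rightarrow> 'a set set \<Rightarrow> bool" where
  "cov u v \<longleftrightarrow> bic u \<and> bic v \<and> (\<exists>w. w \<notin> u \<and> v = insert w u)"

text \<open>For the converse, \<open>cover_exists\<close> puts a one-element extension of
  \<open>u\<close> below \<open>v\<close>, and the absence of intermediate sets makes it equal to
  \<open>v\<close>.\<close>

lemma cov_iff: "cov u v \<longleftrightarrow> bic u \<and> bic v \<and> u \<subset> v \<and> \<not> (\<exists>w. bic w \<and> u \<subset> w \<and> w \<subset> v)"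
proof
  assume "cov u v"
  then show "bic u \<and> bic v \<and> u \<subset> v \<and> \<not> (\<exists>w. bic w \<and> u \<subset> w \<and> w \<subset> v)"
    unfolding cov_def by blast
next
  assume r: "bic u \<and> bic v \<and> u \<subset> v \<and> \<not> (\<exists>w. bic w \<and> u \<subset> w \<and> w \<subset> v)"
  then obtain s where s: "s \<in> v - u" "bic (insert s u)" using cover_exists[of u v] by blast
  then have "insert s u = v" using r by blast
  then show "cov u v" using r s unfolding cov_def by blast
qed

lemma cov_compl:
  assumes "cov u v"
  shows "cov (S - v) (S - u)"
proof -
  obtain w where w: "bic u" "bic v" "w \<notin> u" "v = insert w u"
    using assms unfolding cov_def by blast
  have "w \<in> S" using bic_subset[OF w(2)] w(4) by simp
  then have "w \<notin> S - v" "S - u = insert w (S - v)" using w(3,4) by auto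
  then show ?thesis using bic_compl[OF w(1)] bic_compl[OF w(2)] unfolding cov_def by blast
qed

text \<open>If \<open>t = s \<union> r\<close>, coclosedness of \<open>insert t z\<close> forces
  \<open>r\<close> into \<open>z\<close>; then closedness of \<open>insert s z\<close> forces
  \<open>t\<close> into that set, a contradiction.\<close>

lemma not_split_of_covers:
  assumes "bic z" "bic (insert s z)" "bic (insert t z)" "s \<notin> z" "t \<notin> z" "s \<noteq> t"
  shows "\<not> split s t"
proof
  assume "split s t"
  then obtain r where r: "comp s r" "s \<union> r = t" unfolding split_def by blast
  then have "r \<in> insert t z" using bic_coclosed[OF assms(3) r(1)] assms by auto
  then have "r \<in> insert s z" using comp_psubset[OF r(1)] r by blast
  then show False using bic_closed[OF assms(2) r(1)] r(2) assms by blast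
qed

text \<open>Composing \<open>s\<close> or \<open>t\<close> with an element of \<open>z\<close> gives
  something longer, which therefore already lies in \<open>z\<close>. A composition of
  \<open>s \<union> t\<close> with an element of \<open>z\<close> reassociates into two such steps.
  Hence only \<open>s \<union> t\<close> itself can be new.\<close>

lemma join_of_covers:
  assumes z: "bic z" and sz: "bic (insert s z)" and tz: "bic (insert t z)"
    and "s \<notin> z" "t \<notin> z"
  shows "cl (insert s z \<union> insert t z) = insert s (insert t z) \<union> {u. comp s t \<and> u = s \<union> t}"
    (is "cl ?X = ?Y")
proof
  have st: "s \<union> b \<in> z" if "comp s b" "b \<in> z" for b
    using bic_closed[OF sz, of s b] that comp_psubset[of s b] by blast
  have ts: "t \<union> b \<in> z" if "comp t b" "b \<in> z" for b
    using bic_closed[OF tz, of t b] that comp_psubset[of t b] by blast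
  have uz: "s \<union> t \<union> b \<in> z" if "comp s t" "comp (s \<union> t) b" "b \<in> z" for b
    using assoc[OF that(1,2)] st ts that(3) by (metis Un_assoc Un_left_commute)
  have no: "\<not> comp (s \<union> t) s" "\<not> comp (s \<union> t) t" "\<not> comp s (s \<union> t)" "\<not> comp t (s \<union> t)"
    using comp_psubset by blast+
  have step: "a \<union> b \<in> ?Y" if "a \<in> ?Y" "b \<in> ?Y" "comp a b" for a b
  proof -
    have 1: "a \<union> b \<in> ?Y" if "a \<in> z" "b \<in> ?Y" "comp a b" for a b
      using that st[OF comp_sym] ts[OF comp_sym] uz[OF _ comp_sym] bic_closed[OF z]
      by (auto simp: Un_commute)
    have "a \<union> b \<in> ?Y" if "b \<in> z"
      using 1[OF that \<open>a \<in> ?Y\<close> comp_sym[OF \<open>comp a b\<close>]] by (simp add: Un_commute)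
    moreover have "a \<union> b \<in> ?Y" if "a \<notin> z" "b \<notin> z"
    proof -
      have "a \<in> {s, t, s \<union> t}" "b \<in> {s, t, s \<union> t}" using \<open>a \<in> ?Y\<close> \<open>b \<in> ?Y\<close> that by auto
      then have "a = s \<and> b = t \<or> a = t \<and> b = s"
        using \<open>comp a b\<close> no not_comp_self by blast
      then show ?thesis using \<open>comp a b\<close> comp_sym by blast
    qed
    ultimately show ?thesis using 1 that by blast
  qed
  show "cl ?X \<subseteq> ?Y"
  proof
    fix u assume "u \<in> cl ?X"
    then show "u \<in> ?Y" by induction (use step in blast)+
  qed
  show "?Y \<subseteq> cl ?X"
    using cl.base[of _ ?X] cl.step[of s ?X t] by blast
qed

section \<open>Labels along the chains of a polygon\<close>

definition chain_between :: "'a set set \<Rightarrow> 'a set set \<Rightarrow> 'a set set set \<Rightarrow> bool" where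
  "chain_between z w C \<longleftrightarrow>
     (\<forall>u \<in> C. bic u \<and> z \<subseteq> u \<and> u \<subseteq> w) \<and> (\<forall>u \<in> C. \<forall>v \<in> C. u \<subseteq> v \<or> v \<subseteq> u)"

text \<open>What the polygon arguments use of a labeling: its first component is the added segment,
  and the label depends only on that segment and its splits below. The second component has an
  arbitrary type, so that the property can also be checked for the labeling transported by
  complementation.\<close>

definition cover_label :: "('a set set \<Rightarrow> 'a set set \<Rightarrow> 'a set \<times> 'b) \<Rightarrow> bool" where
  "cover_label lab \<longleftrightarrow>
     (\<forall>B s. bic B \<and> bic (insert s B) \<and> s \<notin> B \<longrightarrow> fst (lab B (insert s B)) = s) \<and>
     (\<forall>B B' s. bic B \<and> bic (insert s B) \<and> s \<notin> B \<and> bic B' \<and> bic (insert s B') \<and> s \<notin> B' \<and>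
        (\<forall>r. split r s \<longrightarrow> r \<in> B \<longleftrightarrow> r \<in> B') \<longrightarrow> lab B (insert s B) = lab B' (insert s B'))"

lemma cover_label_fst:
  "cover_label lab \<Longrightarrow> bic B \<Longrightarrow> bic (insert s B) \<Longrightarrow> s \<notin> B \<Longrightarrow> fst (lab B (insert s B)) = s"
  unfolding cover_label_def by blast

lemma cover_label_eq:
  assumes "cover_label lab" "bic B" "bic (insert s B)" "s \<notin> B"
    "bic B'" "bic (insert s B')" "s \<notin> B'" "\<And>r. split r s \<Longrightarrow> r \<in> B \<longleftrightarrow> r \<in> B'"
  shows "lab B (insert s B) = lab B' (insert s B')"
  using assms unfolding cover_label_def by blast

text \<open>The last step of a chain through \<open>x\<close> adds \<open>t\<close>. The label
  agrees with that of \<open>z\<close> to \<open>y\<close> because the join exceeds \<open>z\<close>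
  only by \<open>s\<close>, \<open>t\<close> and possibly \<open>s \<union> t\<close>, none of which
  is a split of \<open>t\<close>.\<close>

lemma polygon_top:
  assumes lab: "cover_label lab" and zx: "cov z x" and zy: "cov z y"
    and C: "chain_between z (cl (x \<union> y)) C" and "x \<in> C" "x' \<in> C" and top: "cov x' (cl (x \<union> y))"
  shows "lab x' (cl (x \<union> y)) = lab z y"
proof -
  from zx zy obtain s t where z: "bic z" and x: "x = insert s z" "bic (insert s z)" "s \<notin> z"
    and y: "y = insert t z" "bic (insert t z)" "t \<notin> z" unfolding cov_def by blast
  let ?J = "cl (x \<union> y)"
  have J: "?J = insert s (insert t z) \<union> {u. comp s t \<and> u = s \<union> t}"
    using join_of_covers[OF z x(2) y(2) x(3) y(3)] x(1) y(1) by simp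
  obtain w where w: "bic x'" "bic ?J" "w \<notin> x'" "?J = insert w x'"
    using top unfolding cov_def by blast
  have zx': "z \<subseteq> x'" and comparable: "x' \<subseteq> x \<or> x \<subseteq> x'"
    using C \<open>x \<in> C\<close> \<open>x' \<in> C\<close> unfolding chain_between_def by blast+
  show ?thesis
  proof (cases "s = t")
    \<comment> \<open>Here \<open>x = y\<close>, so the join is \<open>y\<close> and the polygon
      collapses to the single cover from \<open>z\<close> to \<open>y\<close>.\<close>
    case True
    then have "?J = y" using J x y not_comp_self by auto
    moreover have "w = t" using calculation w zx' y(1) by auto
    then have "x' = z" using calculation w y by (simp add: insert_ident)
    ultimately show ?thesis by simp
  next
    case False
    have "w = t"
    proof (rule ccontr)
      \<comment> \<open>If \<open>t\<close> came earlier, then \<open>x'\<close> is not below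
        \<open>x\<close>, so it contains \<open>s\<close> as well; the last segment would be
        \<open>s \<union> t\<close>, which closedness already puts in \<open>x'\<close>.\<close>
      assume "w \<noteq> t"
      then have "t \<in> x'" using w J by auto
      then have "s \<in> x'" using comparable x y False by auto
      have "w \<in> ?J" using w by simp
      then have "comp s t" "w = s \<union> t"
        using J w(3) zx' \<open>w \<noteq> t\<close> \<open>s \<in> x'\<close> by auto
      then show False using bic_closed[OF w(1)] \<open>s \<in> x'\<close> \<open>t \<in> x'\<close> w(3) by auto
    qed
    have "lab x' (insert t x') = lab z (insert t z)"
    proof (rule cover_label_eq[OF lab w(1) _ _ z y(2,3)])
      show "bic (insert t x')" "t \<notin> x'" using w \<open>w = t\<close> by auto
      fix r assume r: "split r t"
      have "r \<noteq> s" using r not_split_of_covers[OF z x(2) y(2) x(3) y(3) False] by blast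
      moreover have "r \<noteq> s \<union> t" "r \<noteq> t" using split_psubset[OF r] by auto
      moreover have "r \<in> ?J \<longleftrightarrow> r = t \<or> r \<in> x'" using w \<open>w = t\<close> by simp
      moreover have "r \<in> ?J \<longleftrightarrow> r \<in> z \<or> r = s \<or> r = t \<or> comp s t \<and> r = s \<union> t" using J by auto
      ultimately show "r \<in> x' \<longleftrightarrow> r \<in> z" by blast
    qed
    then show ?thesis using w \<open>w = t\<close> y by simp
  qed
qed

text \<open>Above \<open>z\<close> the chain contains \<open>s\<close>. Adding \<open>t\<close> at a
  later step would bring in \<open>s \<union> t\<close> and reach the join. An interior step thus
  adds \<open>s \<union> t\<close>, which properly contains both \<open>s\<close> and
  \<open>t\<close>.\<close>

lemma polygon_interior:
  assumes lab: "cover_label lab" and zx: "cov z x" and zy: "cov z y"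
    and C: "chain_between z (cl (x \<union> y)) C" and "x \<in> C" "u \<in> C" "v \<in> C"
    and uv: "cov u v" and "u \<noteq> z" "v \<noteq> cl (x \<union> y)"
  shows "fst (lab z x) \<subset> fst (lab u v) \<and> fst (lab z y) \<subset> fst (lab u v)"
proof -
  from zx zy obtain s t where z: "bic z" and x: "x = insert s z" "bic (insert s z)" "s \<notin> z"
    and y: "y = insert t z" "bic (insert t z)" "t \<notin> z" unfolding cov_def by blast
  let ?J = "cl (x \<union> y)"
  have J: "?J = insert s (insert t z) \<union> {u. comp s t \<and> u = s \<union> t}"
    using join_of_covers[OF z x(2) y(2) x(3) y(3)] x(1) y(1) by simp
  obtain w where w: "bic u" "bic v" "w \<notin> u" "v = insert w u"
    using uv unfolding cov_def by blast
  have C': "z \<subseteq> u" "v \<subseteq> ?J" "u \<subseteq> x \<or> x \<subseteq> u"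
    using C \<open>x \<in> C\<close> \<open>u \<in> C\<close> \<open>v \<in> C\<close> unfolding chain_between_def by blast+
  have su: "s \<in> u" using C'(1,3) \<open>u \<noteq> z\<close> unfolding x(1) by (metis insertI1 subsetD subset_antisym subset_insert)
  have "w \<noteq> t"
  proof
    assume "w = t"
    obtain e where e: "e \<in> ?J" "e \<notin> v" using C'(2) \<open>v \<noteq> ?J\<close> by auto
    then have "comp s t" "e = s \<union> t" using J C'(1) w(4) su \<open>w = t\<close> by auto
    then show False using bic_closed[OF w(2)] su w(4) \<open>w = t\<close> e(2) by auto
  qed
  have "w \<in> ?J" using w(4) C'(2) by auto
  then have "comp s t" "w = s \<union> t" using w(3) C'(1) J su \<open>w \<noteq> t\<close> by auto
  then have "s \<subset> w" "t \<subset> w" using comp_psubset[of s t] by auto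
  then show ?thesis
    using cover_label_fst[OF lab] w x y z by simp
qed

text \<open>The label determines the added segment, and along a chain a segment is added at most
  once.\<close>

lemma polygon_inj:
  assumes lab: "cover_label lab" and C: "chain_between z w C"
  shows "inj_on (\<lambda>(u, v). lab u v) {(u, v). u \<in> C \<and> v \<in> C \<and> cov u v}"
proof (rule inj_onI, clarify)
  fix u v u' v'
  assume mem: "u \<in> C" "v \<in> C" "u' \<in> C" "v' \<in> C" and "cov u v" "cov u' v'"
    and eq: "lab u v = lab u' v'"
  then obtain a b where a: "bic u" "bic v" "a \<notin> u" "v = insert a u"
    and b: "bic u'" "bic v'" "b \<notin> u'" "v' = insert b u'" unfolding cov_def by blast
  have "a = b" using cover_label_fst[OF lab] a b eq by metis
  moreover have "u \<subseteq> u' \<or> u' \<subseteq> u" "v \<subseteq> u' \<or> u' \<subseteq> v" "v' \<subseteq> u \<or> u \<subseteq> v'"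
    using mem C unfolding chain_between_def by blast+
  ultimately have "u = u'" using a b by (metis insertI1 insert_subset subsetD subset_antisym subset_insert)
  then show "u = u' \<and> v = v'" using \<open>a = b\<close> a b by simp
qed

text \<open>
  Suppose \<open>s\<close> is a composition of segments avoiding \<open>j\<close> or \<open>j'\<close>. Reading it from one end, each initial
  part is a split of \<open>s\<close> avoiding both, as the splits of \<open>s\<close> in \<open>j\<close> and \<open>j'\<close> agree; so \<open>s\<close> avoids both.
\<close>

lemma label_in_meet:
  assumes j: "bic j" and j': "bic j'" and s: "s \<in> j" "s \<in> j'"
    and agree: "\<And>r. split r s \<Longrightarrow> r \<in> j \<longleftrightarrow> r \<in> j'"
    and break: "\<And>a b. comp a b \<Longrightarrow> a \<union> b = s \<Longrightarrow> a \<notin> j \<or> b \<notin> j"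
  shows "s \<notin> cl ((S - j) \<union> (S - j'))"
proof
  define E where "E = {r. (r = s \<or> split r s) \<and> r \<in> j}"
  have E: "E \<subseteq> j" "E \<subseteq> j'" "s \<in> E" using agree s unfolding E_def by auto
  have outside: "r \<notin> j" "r \<notin> j'" if "split r s" "r \<notin> E" for r
    using that agree[of r] unfolding E_def by auto
  \<comment> \<open>The invariant for the induction over the closure: \<open>u\<close> is outside
    \<open>E\<close>, and prolonging by \<open>u\<close> a split of \<open>s\<close> outside
    \<open>E\<close> does not lead into \<open>E\<close>.\<close>
  define Q where
    "Q u \<longleftrightarrow> u \<notin> E \<and> (\<forall>a. split a s \<and> a \<notin> E \<and> comp a u \<longrightarrow> a \<union> u \<notin> E)" for u
  assume "s \<in> cl ((S - j) \<union> (S - j'))"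
  moreover have "Q u" if "u \<in> cl ((S - j) \<union> (S - j'))" for u
    using that
  proof induction
    case (base u)
    then obtain k where k: "u \<notin> k" "k = j \<or> k = j'" by blast
    then have "bic k" "E \<subseteq> k" "\<And>r. split r s \<Longrightarrow> r \<notin> E \<Longrightarrow> r \<notin> k" using j j' E outside by blast+
    then show ?case unfolding Q_def using bic_coclosed k(1) by blast
  next
    case (step u v)
    have first: False if "a \<notin> E" "Q b" "comp a b" "a \<union> b \<in> E" "split a s" for a b
      using that unfolding Q_def by blast
    have extend: "split a' s" if "split a s" "a \<subseteq> a'" "a' \<in> S" "a' \<subset> s" for a a'
      using that split_extend unfolding split_def by blast
    have E_sub: "r \<subseteq> s" "r \<in> S" if "r \<in> E" for r
      using that split_psubset bic_subset[OF j] unfolding E_def by blast+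
    have "u \<union> v \<notin> E"
    proof
      assume uv: "u \<union> v \<in> E"
      \<comment> \<open>As \<open>u \<union> v\<close> is \<open>s\<close> or a split of
        \<open>s\<close>, whichever of \<open>u\<close> and \<open>v\<close> reaches an end of
        \<open>s\<close> is itself a split of \<open>s\<close>, and \<open>first\<close> can start
        from it.\<close>
      have "split u s \<or> split v s"
      proof (cases "u \<union> v = s")
        case True
        then show ?thesis using step unfolding split_def by blast
      next
        case False
        then obtain b where "comp (u \<union> v) b" "u \<union> v \<union> b = s"
          using uv unfolding E_def split_def by blast
        then show ?thesis
          using assoc[OF \<open>comp u v\<close>, of b] unfolding split_def
          by (metis Un_assoc Un_left_commute)
      qed
      then show False
        using first[of u v] first[of v u] uv step comp_sym unfolding Q_def
        by (metis Un_commute)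
    qed
    moreover have "a \<union> (u \<union> v) \<notin> E" if a: "split a s" "a \<notin> E" "comp a (u \<union> v)" for a
    proof
      assume auv: "a \<union> (u \<union> v) \<in> E"
      \<comment> \<open>Here \<open>q\<close> is the part adjacent to \<open>a\<close>. First
        \<open>a \<union> q\<close> is again a split outside \<open>E\<close>, by
        \<open>Q q\<close>; then \<open>p\<close> prolongs it, and \<open>Q p\<close>
        applies.\<close>
      have no: False if "comp q a" "comp p (q \<union> a)" "Q p" "Q q" "p \<union> q = u \<union> v" for p q
      proof -
        have aq: "a \<union> q \<notin> E" using that a comp_sym unfolding Q_def by blast
        have "a \<union> q \<union> p \<in> E" using that(5) auv by (metis Un_assoc Un_commute)
        moreover have "a \<union> q \<subset> a \<union> q \<union> p"
          using comp_psubset(2)[OF that(2)] by blast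
        ultimately have "split (a \<union> q) s"
          using extend[OF a(1), of "a \<union> q"] E_sub comp_mem[OF that(1)]
          by (metis Un_commute Un_upper1 psubset_subset_trans)
        then show False
          using first[OF aq \<open>Q p\<close>] comp_sym[OF that(2)] \<open>a \<union> q \<union> p \<in> E\<close> by (metis Un_commute)
      qed
      show False
        using assoc[OF \<open>comp u v\<close> comp_sym[OF a(3)]] no[of v u] no[of u v] step
        by (metis Un_commute)
    qed
    ultimately show ?case unfolding Q_def by blast
  qed
  ultimately show False using E unfolding Q_def by blast
qed

text \<open>Each break of \<open>s\<close> has exactly one part in \<open>B\<close>: at most one
  because \<open>B\<close> is closed and omits \<open>s\<close>, at least one because
  \<open>insert s B\<close> is coclosed. Sending a split to its break is therefore a
  bijection.\<close>

lemma card_label: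
  assumes B: "bic B" and sB: "bic (insert s B)" and s: "s \<notin> B"
  shows "card {r. split r s \<and> r \<in> B} = card {{r, r'} | r r'. comp r r' \<and> r \<union> r' = s}"
proof -
  \<comment> \<open>The choice is unambiguous: by \<open>comp_unique\<close> a split has only one
    complementary part.\<close>
  define f where "f r = {r, SOME r'. comp r r' \<and> r \<union> r' = s}" for r
  have f: "f r = {r, r'}" if "comp r r'" "r \<union> r' = s" for r r'
  proof -
    have "(SOME r'. comp r r' \<and> r \<union> r' = s) = r'"
      using that comp_unique by (intro some_equality) auto
    then show ?thesis unfolding f_def by simp
  qed
  have "inj_on f {r. split r s \<and> r \<in> B}"
  proof (rule inj_onI, clarify)
    fix r q assume "split r s" "split q s" "r \<in> B" "q \<in> B" and eq: "f r = f q"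
    then obtain r' q' where r: "comp r r'" "r \<union> r' = s" and q: "comp q q'" "q \<union> q' = s"
      unfolding split_def by blast
    have "{r, r'} = {q, q'}" using eq f[OF r] f[OF q] by simp
    then show "r = q"
      using bic_closed[OF B r(1) \<open>r \<in> B\<close>] r(2) s \<open>q \<in> B\<close> by (auto simp: doubleton_eq_iff)
  qed
  moreover have "f ` {r. split r s \<and> r \<in> B} = {{r, r'} | r r'. comp r r' \<and> r \<union> r' = s}"
  proof
    show "f ` {r. split r s \<and> r \<in> B} \<subseteq> {{r, r'} | r r'. comp r r' \<and> r \<union> r' = s}"
    proof clarify
      fix r assume "split r s"
      then obtain r' where r: "comp r r'" "r \<union> r' = s" unfolding split_def by blast
      from f[OF r] r show "\<exists>q q'. f r = {q, q'} \<and> comp q q' \<and> q \<union> q' = s"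
        by (intro exI conjI)
    qed
    show "{{r, r'} | r r'. comp r r' \<and> r \<union> r' = s} \<subseteq> f ` {r. split r s \<and> r \<in> B}"
    proof clarify
      fix r r' assume r: "comp r r'" and s': "s = r \<union> r'"
      have "r \<in> insert s B \<or> r' \<in> insert s B" using bic_coclosed[OF sB r] s' by simp
      then have "r \<in> B \<or> r' \<in> B" using comp_psubset[OF r] s' by auto
      then show "{r, r'} \<in> f ` {q. split q (r \<union> r') \<and> q \<in> B}"
      proof
        assume "r \<in> B"
        then show ?thesis
          using f[OF r] s' r unfolding split_def by (intro image_eqI[of _ _ r]) auto
      next
        assume "r' \<in> B"
        moreover have r': "comp r' r" "r' \<union> r = s" using comp_sym[OF r] s' by auto
        ultimately show ?thesis
          using f[OF r'] s' unfolding split_def by (intro image_eqI[of _ _ r']) auto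
      qed
    qed
  qed
  ultimately show ?thesis using card_image by fastforce
qed

section \<open>Duality by complementation\<close>

lemma cover_label_dual:
  assumes "cover_label lab"
  shows "cover_label (\<lambda>x y. lab (S - y) (S - x))"
proof -
  \<comment> \<open>A cover adding \<open>s\<close> becomes, between complements, again a cover
    adding \<open>s\<close>. Membership of the splits is negated, so agreement between two lower
    sets is preserved.\<close>
  have eq: "S - B = insert s (S - insert s B)" if "bic (insert s B)" "s \<notin> B" for s B
    using bic_subset[OF that(1), of s] that(2) by auto
  show ?thesis
    unfolding cover_label_def
  proof (intro conjI allI impI; elim conjE)
    fix B s assume B: "bic B" "bic (insert s B)" "s \<notin> B"
    show "fst (lab (S - insert s B) (S - B)) = s"
      using cover_label_fst[OF assms, of "S - insert s B" s] bic_compl[OF B(1)] bic_compl[OF B(2)]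
        eq[OF B(2,3)] by simp
  next
    fix B B' s assume B: "bic B" "bic (insert s B)" "s \<notin> B"
      and B': "bic B'" "bic (insert s B')" "s \<notin> B'"
      and agree: "\<forall>r. split r s \<longrightarrow> (r \<in> B) = (r \<in> B')"
    note bics = bic_compl[OF B(2)] bic_compl[OF B(1), unfolded eq[OF B(2,3)]]
      bic_compl[OF B'(2)] bic_compl[OF B'(1), unfolded eq[OF B'(2,3)]]
    have "lab (S - insert s B) (insert s (S - insert s B)) =
        lab (S - insert s B') (insert s (S - insert s B'))"
      by (rule cover_label_eq[OF assms bics(1,2) _ bics(3,4)]) (use agree in auto)
    then show "lab (S - insert s B) (S - B) = lab (S - insert s B') (S - B')"
      using eq[OF B(2,3)] eq[OF B'(2,3)] by simp
  qed
qed

lemma chain_between_compl: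
  assumes C: "chain_between w z C"
  shows "chain_between (S - z) (S - w) ((-) S ` C)"
proof -
  have "bic u \<and> w \<subseteq> u \<and> u \<subseteq> z" if "u \<in> C" for u
    using C that unfolding chain_between_def by blast
  moreover have "S - u \<subseteq> S - v \<or> S - v \<subseteq> S - u" if "u \<in> C" "v \<in> C" for u v
    using C that Diff_mono[OF subset_refl] unfolding chain_between_def by metis
  ultimately show ?thesis
    unfolding chain_between_def by (simp add: bic_compl Diff_mono)
qed

lemma bic_compl_eq_iff: "bic x \<Longrightarrow> bic y \<Longrightarrow> S - x = S - y \<longleftrightarrow> x = y"
  using compl_compl by metis

section \<open>Join-irreducible biclosed sets\<close>

definition join_irred :: "'a set set \<Rightarrow> bool" where
  "join_irred j \<longleftrightarrow> bic j \<and> (\<forall>x y. bic x \<and> bic y \<and> j = cl (x \<union> y) \<longrightarrow> j = x \<or> j = y)"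

text \<open>Let \<open>?m\<close> be the meet of the two sets. It contains \<open>s\<close> by
  \<open>label_in_meet\<close>, so \<open>insert s i\<close> is the join of \<open>?m\<close> and
  \<open>i\<close>. It differs from \<open>i\<close>, hence equals \<open>?m\<close>; the same holds
  for \<open>insert s i'\<close>.\<close>

lemma join_irred_unique:
  assumes "join_irred (insert s i)" "join_irred (insert s i')"
    and i: "bic i" "bic i'" "s \<notin> i" "s \<notin> i'"
    and agree: "\<And>r. split r s \<Longrightarrow> r \<in> i \<longleftrightarrow> r \<in> i'"
  shows "insert s i = insert s i'"
proof -
  let ?j = "insert s i" and ?j' = "insert s i'"
  have j: "bic ?j" "bic ?j'" using assms unfolding join_irred_def by auto
  let ?m = "S - cl ((S - ?j) \<union> (S - ?j'))"
  have m: "bic ?m" "?m \<subseteq> ?j" "?m \<subseteq> ?j'"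
    using bic_compl[OF bic_join[OF bic_compl[OF j(1)] bic_compl[OF j(2)]]]
      subset_cl[of "(S - ?j) \<union> (S - ?j')"] bic_def j by auto
  have "s \<in> ?m"
  proof -
    have "a \<notin> ?j \<or> b \<notin> ?j" if "comp a b" "a \<union> b = s" for a b
      using that bic_closed[OF i(1)] i(3) comp_psubset by blast
    then have "s \<notin> cl ((S - ?j) \<union> (S - ?j'))"
      using label_in_meet[OF j, of s] agree split_psubset by blast
    then show ?thesis using bic_subset[OF j(1), of s] by simp
  qed
  have eq: "k = ?m" if "join_irred k" "k = insert s l" "bic l" "s \<notin> l" "?m \<subseteq> k" for k l
  proof -
    have "cl (?m \<union> l) \<subseteq> k"
      using cl_least[of "?m \<union> l" k] that unfolding join_irred_def by blast
    moreover have "k \<subseteq> cl (?m \<union> l)" using subset_cl[of "?m \<union> l"] that \<open>s \<in> ?m\<close> by blast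
    ultimately show ?thesis using that m(1) unfolding join_irred_def by blast
  qed
  show ?thesis using eq[of ?j i] eq[of ?j' i'] assms m by metis
qed

end


section \<open>Segments of a tree\<close>

lemma subpath_acyclic:
  assumes "acyclic_path T p" "i < j" "j < length p"
  shows "acyclic_path T (map ((!) p) [i..<Suc j])"
  using assms unfolding acyclic_path_def
  by (auto simp: distinct_map inj_on_def nth_eq_iff_index_eq nth_append subset_iff simp del: upt_Suc)

lemma subpath_segment:
  assumes "segment_path T p" "i < j" "j < length p"
  shows "segment_path T (map ((!) p) [i..<Suc j])"
  using assms subpath_acyclic[of T p i j] unfolding segment_path_def
  by (auto simp: Let_def simp del: upt_Suc)

lemma acyclic_path_rev:
  assumes "acyclic_path T p"
  shows "acyclic_path T (rev p)"
  unfolding acyclic_path_def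
proof (intro conjI allI impI)
  fix j assume j: "Suc j < length (rev p)"
  then have "{p ! (length p - Suc (Suc j)), p ! Suc (length p - Suc (Suc j))} \<in> edges T"
    using assms unfolding acyclic_path_def by auto
  moreover have "Suc (length p - Suc (Suc j)) = length p - Suc j" using j by auto
  ultimately show "{rev p ! j, rev p ! Suc j} \<in> edges T"
    using j by (simp add: rev_nth insert_commute)
qed (use assms in \<open>auto simp: acyclic_path_def\<close>)

text \<open>A chord joining vertices further apart would close the subpath between them to a
  cycle.\<close>

lemma path_edge:
  assumes T: "is_tree T" and p: "acyclic_path T p" and "i < j" "j < length p"
    and e: "{p ! i, p ! j} \<in> edges T"
  shows "j = Suc i"
proof (rule ccontr)
  assume "j \<noteq> Suc i"
  let ?q = "map ((!) p) [i..<Suc j]"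
  have "acyclic_path T ?q" using subpath_acyclic assms by blast
  moreover have "length ?q \<ge> 3" using \<open>i < j\<close> \<open>j \<noteq> Suc i\<close> by auto
  moreover have "hd ?q = p ! i" "last ?q = p ! j"
    using \<open>i < j\<close> by (simp_all add: hd_map last_map)
  ultimately show False using T e unfolding is_tree_def by (metis insert_commute)
qed

text \<open>An injective walk by unit steps cannot turn back, since \<open>f (Suc (Suc k))\<close>
  would then equal \<open>f k\<close>. It is applied to the positions of one path inside
  another.\<close>

lemma unit_steps:
  fixes f :: "nat \<Rightarrow> int"
  assumes inj: "inj_on f {..m}" and step: "\<And>k. k < m \<Longrightarrow> \<bar>f (Suc k) - f k\<bar> = 1"
  obtains d where "d = 1 \<or> d = -1" "\<And>k. k \<le> m \<Longrightarrow> f k = f 0 + d * int k"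
proof (cases "m = 0")
  case True
  then show ?thesis using that[of 1] by simp
next
  case False
  define d where "d = f 1 - f 0"
  have d: "d = 1 \<or> d = -1" using step[of 0] False unfolding d_def by auto
  have const: "f (Suc k) - f k = d" if "k < m" for k
    using that
  proof (induction k)
    case 0
    then show ?case by (simp add: d_def)
  next
    case (Suc k)
    have "f (Suc (Suc k)) \<noteq> f k"
      using inj_onD[OF inj, of "Suc (Suc k)" k] Suc.prems by auto
    then show ?case using Suc step[of "Suc k"] d by auto
  qed
  have "f k = f 0 + d * int k" if "k \<le> m" for k
    using that
  proof (induction k)
    case (Suc k)
    then show ?case using const[of k] by (simp add: algebra_simps)
  qed simp
  then show ?thesis using that d by blast
qed

text \<open>Let \<open>f k\<close> be the position in \<open>p\<close> of the \<open>k\<close>-th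
  vertex of \<open>q\<close>. By \<open>path_edge\<close> consecutive positions differ by one, so
  \<open>q\<close> runs along an interval of \<open>p\<close> in one of the two directions.\<close>

lemma path_in_path:
  assumes T: "is_tree T" and p: "acyclic_path T p" and q: "acyclic_path T q"
    and sub: "set q \<subseteq> set p"
  obtains i j where "i < j" "j < length p" "set q = (!) p ` {i..j}" "hd q \<in> {p ! i, p ! j}"
proof -
  have "\<forall>k. \<exists>l. k < length q \<longrightarrow> l < length p \<and> q ! k = p ! l"
    using sub by (metis in_set_conv_nth nth_mem subsetD)
  then obtain f where f: "\<And>k. k < length q \<Longrightarrow> f k < length p \<and> q ! k = p ! f k"
    by metis
  define m where "m = length q - 1"
  have m: "m \<ge> 1" "\<And>k. k \<le> m \<longleftrightarrow> k < length q" "q \<noteq> []"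
    using q unfolding m_def acyclic_path_def by auto
  have inj: "inj_on (\<lambda>k. int (f k)) {..m}"
    using f m q unfolding acyclic_path_def inj_on_def
    by (metis atMost_iff nth_eq_iff_index_eq of_nat_eq_iff)
  have "\<bar>int (f (Suc k)) - int (f k)\<bar> = 1" if "k < m" for k
  proof -
    have k: "k < length q" "Suc k < length q" using that m(2)[of k] m(2)[of "Suc k"] by linarith+
    have "{q ! k, q ! Suc k} \<in> edges T" using q k unfolding acyclic_path_def by blast
    then have e: "{p ! f k, p ! f (Suc k)} \<in> edges T" using k f[of k] f[of "Suc k"] by simp
    have "f k \<noteq> f (Suc k)" using inj_onD[OF inj, of k "Suc k"] that by auto
    then consider "f k < f (Suc k)" | "f (Suc k) < f k" by linarith
    then show ?thesis
      using path_edge[OF T p, of "f k" "f (Suc k)"] path_edge[OF T p, of "f (Suc k)" "f k"]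
        e f k by cases (auto simp: insert_commute)
  qed
  then obtain d where d: "d = 1 \<or> d = -1"
    and fd: "\<And>k. k \<le> m \<Longrightarrow> int (f k) = int (f 0) + d * int k"
    using unit_steps[OF inj] by blast
  have "set q = (\<lambda>k. q ! k) ` {..m}" using m(2) by (auto simp: set_conv_nth)
  also have "\<dots> = (!) p ` f ` {..m}" using f m(2) unfolding image_image by (intro image_cong) auto
  finally have set_q: "set q = (!) p ` f ` {..m}" .
  have hd_q: "hd q = p ! f 0" using f m by (simp add: hd_conv_nth)
  have f_less: "f 0 < length p" "f m < length p" using f m by auto
  from d show ?thesis
  proof
    assume "d = 1"
    then have fk: "f k = f 0 + k" if "k \<le> m" for k using fd[OF that] by simp
    have "f ` {..m} = (+) (f 0) ` {0..m}" by (rule image_cong[OF _ fk]) auto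
    also have "\<dots> = {f 0..f m}" using fk[of m] by (simp add: add.commute)
    finally have "f ` {..m} = {f 0..f m}" .
    then show ?thesis using that[of "f 0" "f m"] set_q hd_q f_less fk[of m] m(1) by auto
  next
    \<comment> \<open>Here \<open>q\<close> runs backwards, so its head sits at the upper end of the
      interval.\<close>
    assume "d = -1"
    then have fk: "f 0 = f k + k" if "k \<le> m" for k using fd[OF that] by simp
    have "f ` {..m} = {f m..f 0}"
    proof
      show "{f m..f 0} \<subseteq> f ` {..m}"
      proof
        fix l assume l: "l \<in> {f m..f 0}"
        then have "f 0 - l \<le> m" using fk[of m] by auto
        moreover have "f (f 0 - l) = l" using fk[OF calculation] l by auto
        ultimately show "l \<in> f ` {..m}" by (metis atMost_iff image_eqI)
      qed
      show "f ` {..m} \<subseteq> {f m..f 0}"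
      proof
        fix l assume "l \<in> f ` {..m}"
        then obtain k where "k \<le> m" "l = f k" by auto
        then show "l \<in> {f m..f 0}" using fk[of k] fk[of m] by auto
      qed
    qed
    then show ?thesis using that[of "f m" "f 0"] set_q hd_q f_less fk[of m] m(1) by auto
  qed
qed

section \<open>Coordinates on a segment\<close>

definition seg_chart :: "'a embedded_graph \<Rightarrow> (nat \<Rightarrow> 'a) \<Rightarrow> nat \<Rightarrow> bool" where
  "seg_chart T p n \<longleftrightarrow> 0 < n \<and> inj_on p {0..n} \<and>
     (\<forall>i j. i < j \<and> j \<le> n \<longrightarrow> p ` {i..j} \<in> Seg T \<and> ends T (p ` {i..j}) = {p i, p j}) \<and>
     (\<forall>t \<in> Seg T. t \<subseteq> p ` {0..n} \<longrightarrow> (\<exists>i j. i < j \<and> j \<le> n \<and> t = p ` {i..j}))"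

lemma interval_eq:
  assumes "inj_on p {0..n}" "i \<le> j" "j \<le> n" "k \<le> l" "l \<le> n" "p ` {i..j} = p ` {k..l}"
  shows "i = k \<and> j = (l :: nat)"
proof -
  have "{i..j} = {k..l}"
    using assms(6) inj_on_image_eq_iff[OF assms(1), of "{i..j}" "{k..l}"] assms by auto
  then show ?thesis using assms by (simp add: Icc_eq_Icc)
qed

text \<open>The vertex list serves as the coordinate map. Intervals give segments by
  \<open>subpath_segment\<close>, and by \<open>path_in_path\<close> there are no other subsegments.
  Statements about compositions inside \<open>u\<close> thereby become arithmetic of
  intervals.\<close>

lemma seg_chart_exists:
  assumes T: "is_tree T" and "u \<in> Seg T"
  obtains p n where "seg_chart T p n" "u = p ` {0..n}"
proof -
  obtain p where p: "segment_path T p" "u = set p" using assms(2) unfolding Seg_def by blast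
  define n where "n = length p - 1"
  have ap: "acyclic_path T p" using p segment_path_def by blast
  then have n: "0 < n" "\<And>k. k \<le> n \<longleftrightarrow> k < length p" and dist: "distinct p"
    unfolding n_def acyclic_path_def by auto
  have inj: "inj_on ((!) p) {0..n}"
    using dist n by (auto simp: inj_on_def nth_eq_iff_index_eq)
  have u: "u = (!) p ` {0..n}" using p(2) n(2) by (auto simp: set_conv_nth)
  have subset: "\<exists>i j. i < j \<and> j \<le> n \<and> set q = (!) p ` {i..j} \<and> hd q \<in> {p ! i, p ! j}"
    if "acyclic_path T q" "set q \<subseteq> u" for q
    using path_in_path[OF T ap that(1)] that(2) p(2) n(2) by metis
  have interval: "(!) p ` {i..j} \<in> Seg T \<and> ends T ((!) p ` {i..j}) = {p ! i, p ! j}"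
    if ij: "i < j" "j \<le> n" for i j
  proof -
    let ?q = "map ((!) p) [i..<Suc j]"
    have q: "segment_path T ?q" using subpath_segment[OF p(1)] ij n by blast
    have set_q: "set ?q = (!) p ` {i..j}" by (auto simp: atLeastLessThanSuc_atLeastAtMost simp del: upt_Suc)
    have aq: "acyclic_path T ?q" using q segment_path_def by blast
    have hd_q: "hd ?q = p ! i" "hd (rev ?q) = p ! j"
      using ij by (simp_all add: hd_map hd_rev last_map)
    have "p ! i \<in> ends T ((!) p ` {i..j})"
      unfolding ends_def using aq set_q hd_q(1) by (intro CollectI exI[of _ ?q] conjI) simp_all
    moreover have "p ! j \<in> ends T ((!) p ` {i..j})"
      unfolding ends_def using acyclic_path_rev[OF aq] set_q hd_q(2)
      by (intro CollectI exI[of _ "rev ?q"] conjI) simp_all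
    moreover have "x \<in> {p ! i, p ! j}" if "x \<in> ends T ((!) p ` {i..j})" for x
    proof -
      obtain r where r: "acyclic_path T r" "set r = (!) p ` {i..j}" "x = hd r"
        using \<open>x \<in> ends T _\<close> unfolding ends_def by blast
      have "set r \<subseteq> u" unfolding r(2) u by (rule image_mono) (use ij in auto)
      from subset[OF r(1) this] obtain k l where kl: "k < l" "l \<le> n" "set r = (!) p ` {k..l}"
        "hd r \<in> {p ! k, p ! l}" by (elim exE conjE)
      from kl(3) r(2) have "(!) p ` {k..l} = (!) p ` {i..j}" by (rule trans[OF sym])
      then have "k = i \<and> l = j"
        using interval_eq[OF inj, of k l i j] ij kl(1,2) less_imp_le_nat by blast
      then show ?thesis using kl(4) r(3) by simp
    qed
    moreover have "(!) p ` {i..j} \<in> Seg T" unfolding Seg_def using q set_q by blast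
    ultimately show ?thesis by blast
  qed
  have "\<exists>i j. i < j \<and> j \<le> n \<and> t = (!) p ` {i..j}" if "t \<in> Seg T" "t \<subseteq> u" for t
    using that subset unfolding Seg_def segment_path_def by blast
  then have "seg_chart T ((!) p) n"
    unfolding seg_chart_def using n(1) inj interval u by blast
  then show ?thesis using that u by blast
qed

context
  fixes T :: "'a embedded_graph" and p :: "nat \<Rightarrow> 'a" and n :: nat
  assumes chart: "seg_chart T p n"
begin

lemma chart_inj: "inj_on p {0..n}"
  and chart_seg: "i < j \<Longrightarrow> j \<le> n \<Longrightarrow> p ` {i..j} \<in> Seg T"
  and chart_ends: "i < j \<Longrightarrow> j \<le> n \<Longrightarrow> ends T (p ` {i..j}) = {p i, p j}"
  using chart unfolding seg_chart_def by blast+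

lemma chart_sub:
  assumes "t \<in> Seg T" "t \<subseteq> p ` {0..n}"
  obtains i j where "i < j" "j \<le> n" "t = p ` {i..j}"
  using assms chart unfolding seg_chart_def by blast

lemma chart_eq: "i \<le> n \<Longrightarrow> j \<le> n \<Longrightarrow> p i = p j \<longleftrightarrow> i = j"
  using chart_inj by (auto simp: inj_on_def)

lemma chart_Int: "j \<le> n \<Longrightarrow> l \<le> n \<Longrightarrow> p ` {i..j} \<inter> p ` {k..l} = p ` ({i..j} \<inter> {k..l})"
  by (rule inj_on_image_Int[OF chart_inj, symmetric]) auto

lemma chart_Un: "i < j \<Longrightarrow> j < k \<Longrightarrow> p ` {i..j} \<union> p ` {j..k} = p ` {i..k}"
  unfolding image_Un[symmetric] by (subst ivl_disj_un_two_touch) auto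

lemma chart_subset_iff:
  assumes "i < j" "j \<le> n" "k < l" "l \<le> n"
  shows "p ` {i..j} \<subseteq> p ` {k..l} \<longleftrightarrow> k \<le> i \<and> j \<le> l"
proof
  assume sub: "p ` {i..j} \<subseteq> p ` {k..l}"
  have "i \<in> {k..l}" "j \<in> {k..l}"
    using sub assms inj_on_image_mem_iff[OF chart_inj, of i "{k..l}"]
      inj_on_image_mem_iff[OF chart_inj, of j "{k..l}"]
    by (auto simp: image_subset_iff)
  then show "k \<le> i \<and> j \<le> l" by simp
qed auto

lemma chart_composable:
  assumes "i < j" "j < k" "k \<le> n"
  shows "composable T (p ` {i..j}) (p ` {j..k})"
proof -
  have "{i..j} \<inter> {j..k} = {j}" using assms by auto
  then have "p ` {i..j} \<inter> p ` {j..k} = {p j}" using chart_Int assms by simp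
  then show ?thesis
    unfolding composable_def using assms chart_seg chart_ends chart_Un by auto
qed

lemma chart_composable_cases:
  assumes "composable T r s" "r \<union> s = p ` {a..b}" "a < b" "b \<le> n"
  obtains m where "a < m" "m < b" "r = p ` {a..m}" "s = p ` {m..b}"
    | m where "a < m" "m < b" "s = p ` {a..m}" "r = p ` {m..b}"
proof -
  have "p ` {a..b} \<subseteq> p ` {0..n}" using assms by auto
  then have sub: "r \<subseteq> p ` {0..n}" "s \<subseteq> p ` {0..n}" using assms(2) by blast+
  have rs: "r \<in> Seg T" "s \<in> Seg T" using assms(1) unfolding composable_def by auto
  obtain i j where r: "i < j" "j \<le> n" "r = p ` {i..j}" using chart_sub[OF rs(1) sub(1)] .
  obtain k l where s: "k < l" "l \<le> n" "s = p ` {k..l}" using chart_sub[OF rs(2) sub(2)] .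
  obtain v where v: "r \<inter> s = {v}" using assms(1) unfolding composable_def by blast
  have "p ` ({i..j} \<inter> {k..l}) = {v}" using v r s chart_Int by simp
  moreover have "inj_on p ({i..j} \<inter> {k..l})"
    by (rule inj_on_subset[OF chart_inj]) (use r in auto)
  ultimately have "card ({i..j} \<inter> {k..l}) = 1" by (metis card_image is_singletonI is_singleton_altdef)
  \<comment> \<open>Two intervals with a single common point, neither of them degenerate, touch end
    to end.\<close>
  then have "min j l = max i k" by (simp add: Int_atLeastAtMost)
  then have jk: "j = k \<or> l = i" using r(1) s(1) by linarith
  have "p ` ({i..j} \<union> {k..l}) = p ` {a..b}" using assms(2) r s by (simp add: image_Un)
  then have "{i..j} \<union> {k..l} = {a..b}"
    using inj_on_image_eq_iff[OF chart_inj, of "{i..j} \<union> {k..l}" "{a..b}"] r s assms by auto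
  from jk show ?thesis
  proof
    assume "j = k"
    then have "{i..l} = {a..b}"
      using \<open>{i..j} \<union> {k..l} = {a..b}\<close> ivl_disj_un_two_touch(4)[of i j l] r s by auto
    then have "i = a" "l = b" using r s \<open>j = k\<close> by (simp_all add: Icc_eq_Icc)
    then show ?thesis using that(1)[of j] r s \<open>j = k\<close> by simp
  next
    assume "l = i"
    then have "{k..j} = {a..b}"
      using \<open>{i..j} \<union> {k..l} = {a..b}\<close> ivl_disj_un_two_touch(4)[of k i j] r s by (auto simp: Un_commute)
    then have "k = a" "j = b" using r s \<open>l = i\<close> by (simp_all add: Icc_eq_Icc)
    then show ?thesis using that(2)[of l] r s \<open>l = i\<close> by simp
  qed
qed

end

section \<open>Composition, splits and breaks in coordinates\<close>

lemma composable_sym: "composable T s t \<Longrightarrow> composable T t s"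
  unfolding composable_def by (auto simp: Int_commute Un_commute)

text \<open>In coordinates a split is an interval starting at \<open>0\<close> or ending at
  \<open>n\<close>; the interval from its cut vertex to the other end is the missing part.\<close>

lemma split_composable:
  assumes T: "is_tree T" and r: "r \<in> splits T s" and s: "s \<in> Seg T"
  shows "\<exists>b. composable T r b \<and> r \<union> b = s"
proof -
  obtain p n where c: "seg_chart T p n" and s: "s = p ` {0..n}" using seg_chart_exists[OF T s] .
  have n: "0 < n" using c seg_chart_def by blast
  have r: "r \<in> Seg T" "r \<subset> p ` {0..n}" "ends T r \<inter> ends T (p ` {0..n}) \<noteq> {}"
    using r s unfolding splits_def by auto
  obtain i j where ij: "i < j" "j \<le> n" "r = p ` {i..j}" using chart_sub[OF c r(1)] r(2) by blast
  have "i = 0 \<or> j = n"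
    using r(3) ij n by (auto simp: chart_ends[OF c] chart_eq[OF c])
  moreover have ne: "\<not> (i = 0 \<and> j = n)" using r(2) ij by auto
  ultimately show ?thesis
  proof (elim disjE)
    assume "i = 0"
    then have "composable T r (p ` {j..n})" "r \<union> p ` {j..n} = s"
      using chart_composable[OF c, of i j n] chart_Un[OF c, of i j n] ij s ne by auto
    then show ?thesis by blast
  next
    assume "j = n"
    then have "composable T r (p ` {0..i})" "r \<union> p ` {0..i} = s"
      using composable_sym[OF chart_composable[OF c, of 0 i n]] chart_Un[OF c, of 0 i n] ij s ne
      by auto
    then show ?thesis by blast
  qed
qed

text \<open>Exhibits the cut vertex \<open>b\<close>, which brings a composition into the endpoint
  form used by \<open>splits\<close> and \<open>breaks\<close>.\<close>

lemma composable_ends: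
  assumes T: "is_tree T" and rs: "composable T r s"
  obtains a b c where "ends T (r \<union> s) = {a, c}" "b \<in> r \<union> s - {a, c}"
    "r \<in> splits T (r \<union> s)" "ends T r = {a, b}" "s \<in> splits T (r \<union> s)" "ends T s = {b, c}"
proof -
  have "r \<union> s \<in> Seg T" using rs composable_def by metis
  then obtain p n where c: "seg_chart T p n" and u: "r \<union> s = p ` {0..n}"
    using seg_chart_exists[OF T] by blast
  have n: "0 < n" using c seg_chart_def by blast
  have halves: "p ` {0..m} \<in> splits T (r \<union> s)" "p ` {m..n} \<in> splits T (r \<union> s)"
    if "0 < m" "m < n" for m
    unfolding splits_def psubset_eq
    using that n by (auto simp: u chart_seg[OF c] chart_ends[OF c] dest: interval_eq[OF chart_inj[OF c], rotated -1])
  have mid: "p m \<in> r \<union> s - {p 0, p n}" if "0 < m" "m < n" for m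
    unfolding u using that chart_eq[OF c] by auto
  from c rs u n le_refl[of n] show ?thesis
  proof (cases rule: chart_composable_cases)
    case (1 m)
    then show ?thesis
      using that[of "p 0" "p n" "p m"] halves mid n u by (simp add: chart_ends[OF c])
  next
    case (2 m)
    then show ?thesis
      using that[of "p n" "p 0" "p m"] halves mid n u by (simp add: chart_ends[OF c] insert_commute)
  qed
qed

lemma chart_seg_eqI:
  assumes c: "seg_chart T p n" and t: "t \<in> Seg T" "t \<subseteq> p ` {0..n}"
    and e: "ends T t = {p a, p b}" and ab: "a < b" "b \<le> n"
  shows "t = p ` {a..b}"
proof -
  obtain i j where ij: "i < j" "j \<le> n" "t = p ` {i..j}" using chart_sub[OF c t] .
  have "{p i, p j} = {p a, p b}" using e ij chart_ends[OF c] by simp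
  then have "i = a \<and> j = b"
    using ij ab chart_eq[OF c] by (auto simp: doubleton_eq_iff)
  then show ?thesis using ij by simp
qed

lemma segment_system_tree:
  assumes T: "is_tree T" and fin: "finite (verts T)"
  shows "segment_system (Seg T) (composable T)"
proof
  have sub: "Seg T \<subseteq> Pow (verts T)"
    unfolding Seg_def segment_path_def acyclic_path_def by blast
  show "finite (Seg T)" using finite_subset[OF sub] fin by simp
  show "finite s" if "s \<in> Seg T" for s using that sub fin finite_subset by blast
  show "composable T t s" if "composable T s t" for s t using that by (rule composable_sym)
  show "s \<in> Seg T \<and> t \<in> Seg T \<and> s \<union> t \<in> Seg T" if "composable T s t" for s t
    using that unfolding composable_def by blast
  show "\<not> r \<subseteq> s \<inter> t" if st: "composable T s t" and "r \<in> Seg T" for r s t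
  proof
    assume "r \<subseteq> s \<inter> t"
    \<comment> \<open>The two parts share a single vertex, whereas a path has at least two.\<close>
    then obtain v where "r \<subseteq> {v}" using st unfolding composable_def by blast
    moreover obtain q where "acyclic_path T q" "r = set q"
      using \<open>r \<in> Seg T\<close> unfolding Seg_def segment_path_def by blast
    ultimately show False
      using card_mono[of "{v}" r] distinct_card[of q] unfolding acyclic_path_def by auto
  qed
next
  fix s t a b
  assume st: "composable T s t" and ab: "composable T a b" and eq: "s \<union> t = a \<union> b"
  have "s \<union> t \<in> Seg T" using st composable_def by metis
  then obtain p n where c: "seg_chart T p n" and u: "s \<union> t = p ` {0..n}"
    using seg_chart_exists[OF T] by blast
  have n: "0 < n" using c seg_chart_def by blast
  have u': "a \<union> b = p ` {0..n}" using u eq by simp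
  \<comment> \<open>With \<open>m\<close> and \<open>q\<close> the two cut points, the common
    refinement has the interval from \<open>m\<close> to \<open>q\<close> as its middle
    piece.\<close>
  have between: "\<exists>r. composable T (p ` {0..m}) r \<and> p ` {0..q} = p ` {0..m} \<union> r \<and>
      composable T r (p ` {q..n}) \<and> p ` {m..n} = r \<union> p ` {q..n}"
    if "0 < m" "m < q" "q < n" for m q
    using that chart_composable[OF c, of 0 m q] chart_composable[OF c, of m q n]
      chart_Un[OF c, of 0 m q] chart_Un[OF c, of m q n] by (intro exI[of _ "p ` {m..q}"]) simp
  \<comment> \<open>The same middle piece read from the end \<open>n\<close>, for compositions
    listed in the opposite orientation.\<close>
  have between': "\<exists>r. composable T (p ` {q..n}) r \<and> p ` {m..n} = p ` {q..n} \<union> r \<and>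
      composable T r (p ` {0..m}) \<and> p ` {0..q} = r \<union> p ` {0..m}"
    if "0 < m" "m < q" "q < n" for m q
    using between[OF that] composable_sym by (metis Un_commute)
  from c st u n le_refl[of n]
  show "s = a \<and> t = b \<or> s = b \<and> t = a \<or>
      (\<exists>r. composable T s r \<and> a = s \<union> r \<and> composable T r b \<and> t = r \<union> b) \<or>
      (\<exists>r. composable T a r \<and> s = a \<union> r \<and> composable T r t \<and> b = r \<union> t) \<or>
      (\<exists>r. composable T s r \<and> b = s \<union> r \<and> composable T r a \<and> t = r \<union> a) \<or>
      (\<exists>r. composable T b r \<and> s = b \<union> r \<and> composable T r t \<and> a = r \<union> t)"
  proof (cases rule: chart_composable_cases)
    case st: (1 m)
    from c ab u' n le_refl[of n] show ?thesis
    proof (cases rule: chart_composable_cases)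
      case (1 q)
      then show ?thesis
        using st between[of m q] between[of q m] by (cases m q rule: linorder_cases) simp_all
    next
      case (2 q)
      then show ?thesis
        using st between[of m q] between[of q m] by (cases m q rule: linorder_cases) simp_all
    qed
  next
    case st: (2 m)
    from c ab u' n le_refl[of n] show ?thesis
    proof (cases rule: chart_composable_cases)
      case (1 q)
      then show ?thesis
        using st between'[of m q] between'[of q m] by (cases m q rule: linorder_cases) simp_all
    next
      case (2 q)
      then show ?thesis
        using st between'[of m q] between'[of q m] by (cases m q rule: linorder_cases) simp_all
    qed
  qed
next
  fix s t b
  assume st: "composable T s t" and stb: "composable T (s \<union> t) b"
  have "s \<union> t \<union> b \<in> Seg T" using stb composable_def by metis
  then obtain p n where c: "seg_chart T p n" and u: "s \<union> t \<union> b = p ` {0..n}"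
    using seg_chart_exists[OF T] by blast
  have n: "0 < n" using c seg_chart_def by blast
  note comp = chart_composable[OF c] composable_sym[OF chart_composable[OF c]]
    and un = chart_Un[OF c]
  from c stb u n le_refl[of n]
  show "composable T t b \<and> composable T s (t \<union> b) \<or> composable T s b \<and> composable T t (s \<union> b)"
  proof (cases rule: chart_composable_cases)
    case b: (1 m)
    from b have "m \<le> n" by simp
    from c st b(3) b(1) this show ?thesis
    proof (cases rule: chart_composable_cases)
      case (1 k)
      then show ?thesis using b comp(1)[of k m n] comp(1)[of 0 k n] un[of k m n] by simp
    next
      case (2 k)
      then show ?thesis using b comp(1)[of k m n] comp(1)[of 0 k n] un[of k m n] by simp
    qed
  next
    case b: (2 m)
    from c st b(4) b(2) le_refl[of n] show ?thesis
    proof (cases rule: chart_composable_cases)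
      case (1 k)
      then show ?thesis using b comp(2)[of 0 m k] comp(2)[of 0 k n] un[of 0 m k]
        by (simp add: Un_commute)
    next
      case (2 k)
      then show ?thesis using b comp(2)[of 0 m k] comp(2)[of 0 k n] un[of 0 m k]
        by (simp add: Un_commute)
    qed
  qed
next
  fix r b r'
  assume rb: "composable T r b" and r': "r \<subseteq> r'" "r' \<in> Seg T" "r' \<subset> r \<union> b"
  have "r \<union> b \<in> Seg T" using rb composable_def by metis
  then obtain p n where c: "seg_chart T p n" and u: "r \<union> b = p ` {0..n}"
    using seg_chart_exists[OF T] by blast
  have n: "0 < n" using c seg_chart_def by blast
  have "r' \<subseteq> p ` {0..n}" using r'(3) u by simp
  then obtain i j where ij: "i < j" "j \<le> n" "r' = p ` {i..j}" using chart_sub[OF c r'(2)] by blast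
  have ne: "\<not> (i = 0 \<and> j = n)" using r'(3) ij u by auto
  from c rb u n le_refl[of n]
  show "\<exists>b'. composable T r' b' \<and> r' \<union> b' = r \<union> b"
  proof (cases rule: chart_composable_cases)
    case (1 m)
    then have "i = 0" using r'(1) chart_subset_iff[OF c, of 0 m i j] ij by simp
    then show ?thesis
      using chart_composable[OF c, of 0 j n] chart_Un[OF c, of 0 j n] ij ne u
      by (intro exI[of _ "p ` {j..n}"]) simp
  next
    case (2 m)
    then have "j = n" using r'(1) chart_subset_iff[OF c, of m n i j] ij by simp
    then show ?thesis
      using composable_sym[OF chart_composable[OF c, of 0 i n]] chart_Un[OF c, of 0 i n] ij ne u
      by (intro exI[of _ "p ` {0..i}"]) (simp add: Un_commute)
  qed
qed

text \<open>\<open>breaks\<close> prescribes endpoints only. Inside a chart these force the two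
  members to be the intervals on either side of the cut point, which is exactly a
  composition.\<close>

lemma breaks_eq:
  assumes T: "is_tree T" and s: "s \<in> Seg T"
  shows "breaks T s = {{r, r'} | r r'. composable T r r' \<and> r \<union> r' = s}"
proof
  show "{{r, r'} | r r'. composable T r r' \<and> r \<union> r' = s} \<subseteq> breaks T s"
  proof clarify
    fix r r' assume "composable T r r'" "s = r \<union> r'"
    then show "{r, r'} \<in> breaks T (r \<union> r')"
      using composable_ends[OF T, of r r'] unfolding breaks_def by (smt (verit) mem_Collect_eq)
  qed
  show "breaks T s \<subseteq> {{r, r'} | r r'. composable T r r' \<and> r \<union> r' = s}"
  proof
    fix x assume "x \<in> breaks T s"
    then obtain r r' a b d where x: "x = {r, r'}" and e: "ends T s = {a, d}" "b \<in> s - {a, d}"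
      "r \<in> splits T s" "ends T r = {a, b}" "r' \<in> splits T s" "ends T r' = {b, d}"
      unfolding breaks_def by blast
    obtain p n where c: "seg_chart T p n" and u: "s = p ` {0..n}" using seg_chart_exists[OF T s] .
    have n: "0 < n" using c seg_chart_def by blast
    have sub: "r \<in> Seg T" "r \<subseteq> p ` {0..n}" "r' \<in> Seg T" "r' \<subseteq> p ` {0..n}"
      using e(3,5) u unfolding splits_def by auto
    have ad: "{p 0, p n} = {a, d}" using e(1) u n chart_ends[OF c, of 0 n] by simp
    obtain m where m: "m \<le> n" "b = p m" using e(2) u by auto
    have "p m \<notin> {p 0, p n}" using e(2) m(2) ad by simp
    then have "m \<noteq> 0" "m \<noteq> n" by (metis insertI1, metis insertI1 insertI2)
    then have m0: "0 < m" "m < n" using m(1) by simp_all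
    note comp = chart_composable[OF c m0 le_refl] and un = chart_Un[OF c m0]
    from ad consider "a = p 0" "d = p n" | "a = p n" "d = p 0"
      by (auto simp: doubleton_eq_iff)
    then have "composable T r r' \<and> r \<union> r' = s"
    proof cases
      case 1
      then have "r = p ` {0..m}" "r' = p ` {m..n}"
        using chart_seg_eqI[OF c sub(1,2), of 0 m] chart_seg_eqI[OF c sub(3,4), of m n] e m m0
        by auto
      then show ?thesis using comp un u by simp
    next
      case 2
      then have "r' = p ` {0..m}" "r = p ` {m..n}"
        using chart_seg_eqI[OF c sub(3,4), of 0 m] chart_seg_eqI[OF c sub(1,2), of m n] e m m0
        by (auto simp: insert_commute)
      then show ?thesis using composable_sym[OF comp] un u by (simp add: Un_commute)
    qed
    then show "x \<in> {{r, r'} | r r'. composable T r r' \<and> r \<union> r' = s}" using x by blast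
  qed
qed


section \<open>The labeling\<close>

locale embedded_tree =
  fixes T :: "'a embedded_graph"
  assumes tree: "is_tree T" and finite_verts: "finite (verts T)"
begin

sublocale segment_system "Seg T" "composable T"
  using segment_system_tree[OF tree finite_verts] .

section \<open>The lattice of biclosed sets\<close>

lemma biclosed_iff: "biclosed T B \<longleftrightarrow> bic B"
proof -
  have "s \<in> Seg T \<and> t \<in> Seg T \<and> s \<union> t \<in> Seg T" if "composable T s t" for s t
    using that unfolding composable_def by simp
  then show ?thesis
    unfolding biclosed_def closed_segs_def bic_def by (auto 4 4)
qed

lemma carrier_Bic: "carrier (Bic T) = {B. bic B}"
  by (simp add: Bic_def biclosed_iff)

lemma le_Bic: "le (Bic T) x y \<longleftrightarrow> x \<subseteq> y"
  and eq_Bic: "eq (Bic T) x y \<longleftrightarrow> x = y"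
  and lless_Bic: "lless (Bic T) x y \<longleftrightarrow> x \<subset> y"
  by (auto simp: Bic_def lless_def)

lemma partial_order_Bic: "partial_order (Bic T)"
  by unfold_locales (auto simp: Bic_def)

lemma finite_Bic: "finite (carrier (Bic T))"
proof (rule finite_subset)
  show "carrier (Bic T) \<subseteq> Pow (Seg T)" using bic_subset by (auto simp: carrier_Bic)
qed (simp add: finite_S)

lemma least_join:
  assumes "bic x" "bic y"
  shows "least (Bic T) (cl (x \<union> y)) (Upper (Bic T) {x, y})"
proof -
  have "x \<subseteq> cl (x \<union> y)" "y \<subseteq> cl (x \<union> y)" using subset_cl[of "x \<union> y"] by auto
  moreover have "cl (x \<union> y) \<subseteq> w" if "bic w" "x \<subseteq> w" "y \<subseteq> w" for w
    using cl_least[of "x \<union> y" w] that by simp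
  ultimately show ?thesis
    using assms bic_join[OF assms] by (simp add: least_def Upper_def carrier_Bic le_Bic)
qed

text \<open>Complementation preserves biclosedness and reverses inclusion, so the meet is the
  complement of the join of the complements.\<close>

lemma greatest_meet:
  assumes "bic x" "bic y"
  shows "greatest (Bic T) (Seg T - cl ((Seg T - x) \<union> (Seg T - y))) (Lower (Bic T) {x, y})"
proof -
  let ?c = "cl ((Seg T - x) \<union> (Seg T - y))"
  have c: "bic ?c" using assms bic_compl bic_join by simp
  have "Seg T - ?c \<subseteq> x" "Seg T - ?c \<subseteq> y"
    using subset_cl[of "(Seg T - x) \<union> (Seg T - y)"] by auto
  moreover have "w \<subseteq> Seg T - ?c" if "bic w" "w \<subseteq> x" "w \<subseteq> y" for w
  proof -
    have "?c \<subseteq> Seg T - w" by (rule cl_least[OF _ bic_compl[OF that(1)]]) (use that in auto)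
    then show ?thesis using that(1) bic_subset by blast
  qed
  ultimately show ?thesis
    using assms bic_compl[OF c] by (simp add: greatest_def Lower_def carrier_Bic le_Bic)
qed

lemma lattice_Bic: "lattice (Bic T)"
proof -
  interpret partial_order "Bic T" by (rule partial_order_Bic)
  show ?thesis
  proof
    fix x y assume "x \<in> carrier (Bic T)" "y \<in> carrier (Bic T)"
    then have "bic x" "bic y" by (simp_all add: carrier_Bic)
    from least_join[OF this] greatest_meet[OF this]
    show "\<exists>s. least (Bic T) s (Upper (Bic T) {x, y})"
      "\<exists>s. greatest (Bic T) s (Lower (Bic T) {x, y})" by blast+
  qed
qed

lemma join_Bic:
  assumes "bic x" "bic y"
  shows "join (Bic T) x y = cl (x \<union> y)"
  unfolding join_def sup_def using least_join[OF assms]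
  by (rule some_equality) (rule partial_order.least_unique[OF partial_order_Bic _ least_join[OF assms]])

lemma meet_Bic:
  assumes "bic x" "bic y"
  shows "meet (Bic T) x y = Seg T - cl ((Seg T - x) \<union> (Seg T - y))"
  unfolding meet_def inf_def using greatest_meet[OF assms]
  by (rule some_equality)
    (rule partial_order.greatest_unique[OF partial_order_Bic _ greatest_meet[OF assms]])

lemma covers_Bic: "covers (Bic T) x y \<longleftrightarrow> cov x y"
  unfolding covers_def cov_iff by (auto simp: carrier_Bic lless_Bic)

lemma covers_inv_Bic: "covers (inv_gorder (Bic T)) x y \<longleftrightarrow> cov y x"
  unfolding covers_def cov_iff by (auto simp: carrier_Bic lless_def le_Bic eq_Bic)

lemma max_chain_Bic:
  assumes "max_chain (Bic T) z w C"
  shows "chain_between z w C"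
proof -
  have C: "C \<subseteq> {u \<in> Collect bic. z \<subseteq> u \<and> u \<subseteq> w}"
    and total: "\<forall>u\<in>C. \<forall>v\<in>C. (u \<subset> v \<or> u = v) \<or> v \<subset> u \<or> v = u"
    using assms
    unfolding max_chain_def pred_on.maxchain_def pred_on.chain_def at_least_at_most_def
    by (simp_all add: carrier_Bic le_Bic lless_Bic)
  have "u \<subseteq> v \<or> v \<subseteq> u" if "u \<in> C" "v \<in> C" for u v
    using bspec[OF bspec[OF total that(1)] that(2)] by auto
  then show ?thesis unfolding chain_between_def using C by blast
qed

lemma max_chain_inv_Bic:
  assumes "max_chain (inv_gorder (Bic T)) z w C"
  shows "chain_between w z C"
proof -
  have C: "C \<subseteq> {u \<in> Collect bic. u \<subseteq> z \<and> w \<subseteq> u}"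
    and total: "\<forall>u\<in>C. \<forall>v\<in>C. (v \<subseteq> u \<and> u \<noteq> v \<or> u = v) \<or> u \<subseteq> v \<and> v \<noteq> u \<or> v = u"
    using assms
    unfolding max_chain_def pred_on.maxchain_def pred_on.chain_def at_least_at_most_def
    by (simp_all add: carrier_Bic le_Bic lless_def eq_Bic)
  have "u \<subseteq> v \<or> v \<subseteq> u" if "u \<in> C" "v \<in> C" for u v
    using bspec[OF bspec[OF total that(1)] that(2)] by auto
  then show ?thesis unfolding chain_between_def using C by blast
qed

section \<open>Labels and the defining conditions\<close>

lemma splits_eq: "s \<in> Seg T \<Longrightarrow> splits T s = {r. split r s}"
  unfolding split_def using split_composable[OF tree] composable_ends[OF tree] by blast

lemma bic_label_insert:
  assumes "bic (insert s B)" "s \<notin> B"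
  shows "bic_label T B (insert s B) = (s, {r. split r s \<and> r \<in> B})"
proof -
  have "(THE s'. s' \<notin> B \<and> insert s B = B \<union> {s'}) = s"
    using assms by (intro the_equality) auto
  moreover have "s \<in> Seg T" using bic_subset[OF assms(1)] by simp
  ultimately show ?thesis
    unfolding bic_label_def Let_def by (simp add: splits_eq)
qed

lemma cover_label_bic_label: "cover_label (bic_label T)"
  unfolding cover_label_def by (auto simp: bic_label_insert)

lemma lless_label: "lless (label_poset T) l l' \<longleftrightarrow> fst l \<subset> fst l'"
  by (auto simp: label_poset_def lless_def)

lemma partial_order_label_poset: "partial_order (label_poset T)"
  by unfold_locales (auto simp: label_poset_def)

text \<open>The number of splits is \<open>card_label\<close>. Two distinct splits in one break
  would compose to \<open>s\<close> inside the closed set \<open>u\<close>, which omits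
  \<open>s\<close>.\<close>

lemma bic_label_mem:
  assumes "cov u v"
  shows "bic_label T u v \<in> carrier (label_poset T)"
proof -
  obtain s where s: "bic u" "bic v" "s \<notin> u" "v = insert s u"
    using assms unfolding cov_def by blast
  have S: "s \<in> Seg T" using bic_subset[OF s(2)] s(4) by simp
  let ?D = "{r. split r s \<and> r \<in> u}"
  have "?D \<subseteq> splits T s" using splits_eq[OF S] by auto
  moreover have "card ?D = card (breaks T s)"
    using card_label[of u s] s breaks_eq[OF tree S] by simp
  moreover have "\<not> (\<exists>b \<in> breaks T s. r \<in> b \<and> r' \<in> b)" if r: "r \<in> u" "r' \<in> u" "r \<noteq> r'" for r r'
  proof
    assume "\<exists>b \<in> breaks T s. r \<in> b \<and> r' \<in> b"
    then obtain a a' where a: "composable T a a'" "a \<union> a' = s" "r \<in> {a, a'}" "r' \<in> {a, a'}"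
      unfolding breaks_eq[OF tree S] by blast
    then have "a \<in> u" "a' \<in> u" using r by auto
    then show False using bic_closed[OF s(1) a(1)] a(2) s(3) by simp
  qed
  ultimately show ?thesis
    using bic_label_insert[of s u] s S unfolding label_poset_def Labels_def by auto
qed

lemma CN_Bic: "CN_conditions (Bic T) (label_poset T) (bic_label T)"
  unfolding CN_conditions_def covers_Bic
proof (intro allI impI; elim conjE)
  fix z x y C1 C2
  assume zx: "cov z x" and zy: "cov z y"
    and C: "max_chain (Bic T) z (join (Bic T) x y) C1" "max_chain (Bic T) z (join (Bic T) x y) C2"
    and xy: "x \<in> C1" "y \<in> C2"
  have J: "join (Bic T) x y = cl (x \<union> y)" using join_Bic zx zy unfolding cov_def by blast
  \<comment> \<open>The chain \<open>C2\<close> is read with \<open>x\<close> and \<open>y\<close>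
    exchanged, so \<open>polygon_top\<close> yields both halves of (CN1).\<close>
  have C1: "chain_between z (cl (x \<union> y)) C1" and C2: "chain_between z (cl (y \<union> x)) C2"
    using max_chain_Bic C J by (simp_all add: Un_commute)
  note top1 = polygon_top[OF cover_label_bic_label zx zy C1 xy(1)]
    and top2 = polygon_top[OF cover_label_bic_label zy zx C2 xy(2), unfolded Un_commute[of y x]]
    and inj = polygon_inj[OF cover_label_bic_label C1]
  have interior: "fst (bic_label T z x) \<subset> fst (bic_label T u v)"
    "fst (bic_label T z y) \<subset> fst (bic_label T u v)"
    if "u \<in> C1" "v \<in> C1" "cov u v" "z \<subset> u" "v \<subset> cl (x \<union> y)" for u v
    using polygon_interior[OF cover_label_bic_label zx zy C1 xy(1) that(1-3)] that(4,5) by simp_all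
  show "(\<forall>x'\<in>C1. \<forall>y'\<in>C2. cov x' (join (Bic T) x y) \<and> cov y' (join (Bic T) x y) \<longrightarrow>
        bic_label T x' (join (Bic T) x y) = bic_label T z y \<and>
        bic_label T y' (join (Bic T) x y) = bic_label T z x) \<and>
      (\<forall>u\<in>C1. \<forall>v\<in>C1. cov u v \<and> lless (Bic T) z u \<and> lless (Bic T) v (join (Bic T) x y) \<longrightarrow>
        lless (label_poset T) (bic_label T z x) (bic_label T u v) \<and>
        lless (label_poset T) (bic_label T z y) (bic_label T u v)) \<and>
      inj_on (\<lambda>(u, v). bic_label T u v) {(u, v). u \<in> C1 \<and> v \<in> C1 \<and> cov u v}"
    unfolding J lless_Bic lless_label
    by (intro conjI ballI impI inj; elim conjE) (rule top1 top2 interior; assumption)+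
qed

lemma CN_inv_Bic: "CN_conditions (inv_gorder (Bic T)) (label_poset T) (\<lambda>x y. bic_label T y x)"
  unfolding CN_conditions_def covers_inv_Bic join_dual
proof (intro allI impI; elim conjE)
  fix z x y C1 C2
  assume zx: "cov x z" and zy: "cov y z"
    and C: "max_chain (inv_gorder (Bic T)) z (meet (Bic T) x y) C1"
      "max_chain (inv_gorder (Bic T)) z (meet (Bic T) x y) C2"
    and xy: "x \<in> C1" "y \<in> C2"
  \<comment> \<open>In the dual, \<open>x\<close> and \<open>y\<close> lie below \<open>z\<close>,
    and their complements cover that of \<open>z\<close>. The labeling transported to complements is
    again a \<open>cover_label\<close>, so the polygon lemmas apply to it.\<close>
  define lab where "lab = (\<lambda>u v. bic_label T (Seg T - v) (Seg T - u))"
  have lab: "cover_label lab"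
    unfolding lab_def by (rule cover_label_dual[OF cover_label_bic_label])
  have lab_compl: "lab (Seg T - u) (Seg T - v) = bic_label T v u" if "bic u" "bic v" for u v
    using compl_compl that unfolding lab_def by simp
  let ?m = "meet (Bic T) x y" and ?c = "\<lambda>u. Seg T - u"
  have bics: "bic x" "bic y" "bic z" using zx zy unfolding cov_def by auto
  have m: "?m = ?c (cl (?c x \<union> ?c y))" using meet_Bic bics by blast
  have J: "bic (cl (?c x \<union> ?c y))" using bic_compl bic_join bics by blast
  then have m_bic: "bic ?m" and cm: "?c ?m = cl (?c x \<union> ?c y)"
    using bic_compl compl_compl[OF J] m by simp_all
  have C1': "chain_between (?c z) (cl (?c x \<union> ?c y)) (?c ` C1)"
    and C2': "chain_between (?c z) (cl (?c y \<union> ?c x)) (?c ` C2)"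
    using chain_between_compl[OF max_chain_inv_Bic[OF C(1)]]
      chain_between_compl[OF max_chain_inv_Bic[OF C(2)]] unfolding cm by (simp_all add: Un_commute)
  have mem: "bic u" if "u \<in> C1 \<or> u \<in> C2" for u
    using that max_chain_inv_Bic[OF C(1)] max_chain_inv_Bic[OF C(2)]
    unfolding chain_between_def by blast
  have "bic_label T ?m x' = bic_label T y z" if x': "x' \<in> C1" "cov ?m x'" for x'
  proof -
    have "lab (?c x') (?c ?m) = lab (?c z) (?c y)"
      using polygon_top[OF lab cov_compl[OF zx] cov_compl[OF zy] C1', of "?c x'"] xy x'
        cov_compl[OF x'(2)] unfolding cm by blast
    then show ?thesis using lab_compl bics m_bic mem x' by simp
  qed
  moreover have "bic_label T ?m y' = bic_label T x z" if y': "y' \<in> C2" "cov ?m y'" for y'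
  proof -
    have "lab (?c y') (?c ?m) = lab (?c z) (?c x)"
      using polygon_top[OF lab cov_compl[OF zy] cov_compl[OF zx] C2', of "?c y'"] xy y'
        cov_compl[OF y'(2)] unfolding cm by (simp add: Un_commute)
    then show ?thesis using lab_compl bics m_bic mem y' by simp
  qed
  moreover have "fst (bic_label T x z) \<subset> fst (bic_label T v u) \<and>
      fst (bic_label T y z) \<subset> fst (bic_label T v u)"
    if uv: "u \<in> C1" "v \<in> C1" "cov v u" "z \<noteq> u" "v \<noteq> ?m" for u v
  proof -
    have "bic u" "bic v" using mem uv by auto
    then have "?c u \<noteq> ?c z" "?c v \<noteq> cl (?c x \<union> ?c y)"
      using bic_compl_eq_iff bics m_bic uv cm by metis+
    then have "fst (lab (?c z) (?c x)) \<subset> fst (lab (?c u) (?c v)) \<and>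
        fst (lab (?c z) (?c y)) \<subset> fst (lab (?c u) (?c v))"
      using polygon_interior[OF lab cov_compl[OF zx] cov_compl[OF zy] C1', of "?c u" "?c v"]
        xy uv cov_compl[OF uv(3)] by blast
    then show ?thesis using lab_compl bics \<open>bic u\<close> \<open>bic v\<close> by simp
  qed
  \<comment> \<open>Swapping the members of each pair turns this into \<open>polygon_inj\<close> for
    the chain itself.\<close>
  moreover have "inj_on (\<lambda>(u, v). bic_label T v u) {(u, v). u \<in> C1 \<and> v \<in> C1 \<and> cov v u}"
  proof (rule inj_onI, clarify)
    fix u v u' v' assume "u \<in> C1" "v \<in> C1" "cov v u" "u' \<in> C1" "v' \<in> C1" "cov v' u'"
      and "bic_label T v u = bic_label T v' u'"
    then show "u = u' \<and> v = v'"
      using inj_onD[OF polygon_inj[OF cover_label_bic_label max_chain_inv_Bic[OF C(1)]],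
          of "(v, u)" "(v', u')"] by simp
  qed
  ultimately show "(\<forall>x'\<in>C1. \<forall>y'\<in>C2. cov ?m x' \<and> cov ?m y' \<longrightarrow>
        bic_label T ?m x' = bic_label T y z \<and> bic_label T ?m y' = bic_label T x z) \<and>
      (\<forall>u\<in>C1. \<forall>v\<in>C1. cov v u \<and> lless (inv_gorder (Bic T)) z u \<and>
          lless (inv_gorder (Bic T)) v ?m \<longrightarrow>
        lless (label_poset T) (bic_label T x z) (bic_label T v u) \<and>
        lless (label_poset T) (bic_label T y z) (bic_label T v u)) \<and>
      inj_on (\<lambda>(u, v). bic_label T v u) {(u, v). u \<in> C1 \<and> v \<in> C1 \<and> cov v u}"
    unfolding lless_label by (simp add: lless_def eq_Bic)
qed

lemma join_irreducible_Bic: "join_irreducible (Bic T) j \<Longrightarrow> join_irred j"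
  unfolding join_irreducible_def join_irred_def
  by (auto simp: carrier_Bic join_Bic)

lemma meet_irreducible_Bic:
  assumes "meet_irreducible (Bic T) m"
  shows "join_irred (Seg T - m)"
  unfolding join_irred_def
proof (intro conjI allI impI; (elim conjE)?)
  have m: "bic m" "\<And>x y. bic x \<Longrightarrow> bic y \<Longrightarrow> m = meet (Bic T) x y \<Longrightarrow> m = x \<or> m = y"
    using assms unfolding meet_irreducible_def by (auto simp: carrier_Bic)
  show "bic (Seg T - m)" using bic_compl[OF m(1)] .
  fix x y assume xy: "bic x" "bic y" and eq: "Seg T - m = cl (x \<union> y)"
  have "m = meet (Bic T) (Seg T - x) (Seg T - y)"
    using compl_compl[OF m(1)] compl_compl[OF xy(1)] compl_compl[OF xy(2)] eq
      meet_Bic[OF bic_compl[OF xy(1)] bic_compl[OF xy(2)]] by simp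
  then have "m = Seg T - x \<or> m = Seg T - y" using m(2) bic_compl xy by blast
  then show "Seg T - m = x \<or> Seg T - m = y" using compl_compl xy by blast
qed

text \<open>Equal labels give the same segment and the same splits below, so (CU1) follows from
  \<open>join_irred_unique\<close>. For (CU2) the same lemma is applied to complements, where
  \<open>Seg T - m\<close> is join-irreducible and covers \<open>Seg T - n\<close>.\<close>

lemma CU_Bic: "CU_labeling (Bic T) (label_poset T) (bic_label T)"
  unfolding CU_labeling_def CN_labeling_def covers_Bic
proof (intro conjI allI impI; (elim conjE)?)
  fix j j' i i'
  assume j: "join_irreducible (Bic T) j" "join_irreducible (Bic T) j'" "j \<noteq> j'"
    and c: "cov i j" "cov i' j'"
  show "bic_label T i j \<noteq> bic_label T i' j'"
  proof
    assume eq: "bic_label T i j = bic_label T i' j'"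
    obtain s where s: "bic i" "bic j" "s \<notin> i" "j = insert s i" using c unfolding cov_def by blast
    obtain s' where s': "bic i'" "bic j'" "s' \<notin> i'" "j' = insert s' i'"
      using c unfolding cov_def by blast
    have "s = s'" and D: "{r. split r s \<and> r \<in> i} = {r. split r s' \<and> r \<in> i'}"
      using eq s s' bic_label_insert by auto
    then have "r \<in> i \<longleftrightarrow> r \<in> i'" if "split r s" for r using that by blast
    then show False
      using join_irred_unique[of s i i'] join_irreducible_Bic j s s' \<open>s = s'\<close> by blast
  qed
next
  fix m m' n n'
  assume m: "meet_irreducible (Bic T) m" "meet_irreducible (Bic T) m'" "m \<noteq> m'"
    and c: "cov m n" "cov m' n'"
  show "bic_label T m n \<noteq> bic_label T m' n'"
  proof
    assume eq: "bic_label T m n = bic_label T m' n'"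
    obtain s where s: "bic m" "bic n" "s \<notin> m" "n = insert s m" using c unfolding cov_def by blast
    obtain s' where s': "bic m'" "bic n'" "s' \<notin> m'" "n' = insert s' m'"
      using c unfolding cov_def by blast
    have "s = s'" and D: "{r. split r s \<and> r \<in> m} = {r. split r s' \<and> r \<in> m'}"
      using eq s s' bic_label_insert by auto
    \<comment> \<open>A split of \<open>s\<close> differs from \<open>s\<close>, so it lies outside
      \<open>n\<close> exactly when it lies outside \<open>m\<close>, and likewise for
      \<open>n'\<close> and \<open>m'\<close>.\<close>
    then have agree: "r \<in> Seg T - n \<longleftrightarrow> r \<in> Seg T - n'" if "split r s" for r
      using that s(4) s'(4) split_psubset[OF that] by auto
    have S: "s \<in> Seg T" using bic_subset[OF s(2)] s(4) by simp
    have co: "Seg T - m = insert s (Seg T - n)" "Seg T - m' = insert s (Seg T - n')"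
      using s s' S \<open>s = s'\<close> by auto
    have "Seg T - m = Seg T - m'"
      unfolding co
    proof (rule join_irred_unique[OF _ _ _ _ _ _ agree])
      show "join_irred (insert s (Seg T - n))" "join_irred (insert s (Seg T - n'))"
        using meet_irreducible_Bic m unfolding co[symmetric] by auto
    qed (use s s' \<open>s = s'\<close> bic_compl in auto)
    then show False using bic_compl_eq_iff s s' m(3) by blast
  qed
qed (use lattice_Bic finite_Bic partial_order_label_poset bic_label_mem CN_Bic CN_inv_Bic in auto)

end

theorem theorem3p4:
  fixes T :: "'a embedded_graph"
  assumes "disk_tree T"
  shows "CU_labeling (Bic T) (label_poset T) (bic_label T)"
proof -
  interpret embedded_tree T
    by unfold_locales (use assms in \<open>simp_all add: disk_tree_def\<close>)
  show ?thesis by (rule CU_Bic)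
qed

end
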